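(* Let $G$ be a group. There is a free crossed resolution $C_*(G)$ of $G$ in which $C_n(G)$ ($n\ge1$) is free on the set $G^n$, with generators written $[a_1,a_2,\ldots,a_n]$, $a_i\in G$, with $\varphi:C_1(G)\to G$, $[a]\mapsto a$, with contracting homotopy of the universal cover given, in dimensions $n\ge1$, on the free generators by $$h_n(a,[a_1,a_2,\ldots,a_n])=(1,[a,a_1,a_2,\ldots,a_n])$$ and in dimension $0$ by $h_0(a)=(a,\sigma(a)^{-1})$, where $\sigma:G\to C_1(G)$ is the section of $\varphi$ with $\sigma(a)=[a]$ for $a\ne1$ and $\sigma(1)=1$, and with boundaries $\delta_n:C_n(G)\to C_{n-1}(G)$ given by $$\delta_2[a,b]=[a][b][ab]^{-1},\qquad \delta_3[a,b,c]=[a,bc]\,[ab,c]^{-1}\,[a,b]^{-1}\,[b,c]^{[a]^{-1}},$$ and for $n\ge4$ $$\delta_n[a_1,\ldots,a_n]=[a_2,\ldots,a_n]^{a_1^{-1}}+\sum_{i=1}^{n-1}(-1)^i[a_1,\ldots,a_{i-1},a_ia_{i+1},a_{i+2},\ldots,a_n]+(-1)^n[a_1,\ldots,a_{n-1}].$$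
   Context: In a groupoid the composite of $a:x\to y$, $b:y\to z$ is $ab:x\to z$. A crossed module over a groupoid $\Phi$ is a family of groups $M=(M(x))_{x\in Ob\,\Phi}$ with a groupoid morphism $\mu:M\to\Phi$, identity on objects, and a right action of $\Phi$ on $M$ ($m^u\in M(y)$ for $m\in M(x)$, $u\in\Phi(x,y)$) with $\mu(m^u)=u^{-1}\mu(m)u$ and $n^{-1}mn=m^{\mu n}$; over a group this is the usual notion. The free crossed module over a group $F$ on a function $w:S\to F$ is the universal crossed module $\mu:M\to F$ with a function $S\to M$ lifting $w$. A free crossed resolution of a group $G$ consists of: a free group $C_1$ with an epimorphism $\varphi:C_1\to G$; a free crossed module $\delta_2:C_2\to C_1$ with $\delta_2(C_2)=\ker\varphi$ (so $\ker\delta_2$ is a right $G$-module); free right $G$-modules $C_n$, $n\ge3$ (written additively, $C_1$ acting via $\varphi$); and $G$-equivariant homomorphisms $\delta_3:C_3\to\ker\delta_2\subseteq C_2$, $\delta_n:C_n\to C_{n-1}$ ($n\ge4$), such that $\ker\delta_n=\operatorname{im}\delta_{n+1}$ for all $n\ge2$. "$C_n$ is free on $G^n$" means free group for $n=1$, free crossed $C_1$-module (on $\delta_2$ restricted to the generators) for $n=2$, free $G$-module for $n\ge3$. Groups in dimensions 1 and 2 are written multiplicatively. The universal cover $\widetilde C$: $\widetilde C_0=G$; $\widetilde C_1$ is the groupoid on $G$ with arrows $(g,u)\in G\times C_1$, source $\widetilde\delta^0(g,u)=g$, target $\widetilde\delta^1(g,u)=g(\varphi u)$, composition $(g,u)(g(\varphi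 u),v)=(g,uv)$; for $n\ge2$, $\widetilde C_n(g)=\{g\}\times C_n$, $\beta(g,c)=g$, $(g,c)^{(g,u)}=(g(\varphi u),c^u)$, $\widetilde\delta_n(g,c)=(g,\delta_nc)$. It is free on the elements $(g,x)$, $g\in G$, $x$ a free generator of $C_n$. A contracting homotopy of $\widetilde C$ (to the base point $1\in G$) is a family of functions $h_n$ on $\widetilde C_n$, $n\ge0$, such that: $h_0(g)$ is an arrow $g\to1$ of $\widetilde C_1$; $h_1:\widetilde C_1\to\widetilde C_2(1)$ is a groupoid morphism; for $n\ge2$, $h_n:\widetilde C_n\to\widetilde C_{n+1}(1)$ is a morphism (a homomorphism on each $\widetilde C_n(g)$) with $h_n(c^a)=h_n(c)$ whenever $a\in\widetilde C_1$ and $c^a$ is defined; and $\widetilde\delta_2h_1c=(h_0\widetilde\delta^0c)^{-1}c\,(h_0\widetilde\delta^1c)$ for $c\in\widetilde C_1$; $\widetilde\delta_3h_2c=(h_1\widetilde\delta_2c)^{-1}c^{h_0\beta c}$ for $c\in\widetilde C_2$; $\widetilde\delta_{n+1}h_nc=-h_{n-1}\widetilde\delta_nc+c^{h_0\beta c}$ for $c\in\widetilde C_n$, $n\ge3$. For $n\ge1$ the $h_n$ are determined by their values on the free generators.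
   Formalization: The section is taken as σ(a)=[a] for every a, so σ(1)=[1] and h_0(1)=(1,[1]^{-1}), instead of σ(1)=1; with σ(1)=1 and G nontrivial, δ_2h_1(1,[b]) would force the free generator [1] to be trivial. *)

theory Defs
  imports "HOL-Algebra.Algebra"
begin

section \<open>Free groups, free modules and free crossed modules: universal properties\<close>

text \<open>
  HOL cannot quantify over types inside a formula, so each universal property carries a type
  argument \<open>TYPE('t)\<close>: it is tested against all structures whose carrier lives in \<open>'t\<close>.  The type
  variable stays free in theorems about the concrete constructions given further below, so these are
  universal with respect to every type.  All groups, also the modules, are records of type
  \<open>monoid\<close>; the groups of coefficients \<open>free_Abelian_group\<close> have \<open>+\<close> as their operation.
\<close>

definition free_group_on ::
    "'t itself \<Rightarrow> 'f monoid \<Rightarrow> 's set \<Rightarrow> ('s \<Rightarrow> 'f) \<Rightarrow> bool" where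
  "free_group_on T F S \<iota> \<longleftrightarrow>
     group F \<and> \<iota> \<in> S \<rightarrow> carrier F \<and>
     (\<forall>(H :: 't monoid) f. group H \<longrightarrow> f \<in> S \<rightarrow> carrier H \<longrightarrow>
        (\<exists>!k. k \<in> hom F H \<and> k \<in> extensional (carrier F) \<and> (\<forall>s\<in>S. k (\<iota> s) = f s)))"

definition right_action ::
    "('g, 'x) monoid_scheme \<Rightarrow> ('m, 'y) monoid_scheme \<Rightarrow> ('m \<Rightarrow> 'g \<Rightarrow> 'm) \<Rightarrow> bool" where
  "right_action G M act \<longleftrightarrow>
     (\<forall>g\<in>carrier G. (\<lambda>m. act m g) \<in> hom M M) \<and>
     (\<forall>m\<in>carrier M. act m \<one>\<^bsub>G\<^esub> = m) \<and>
     (\<forall>m\<in>carrier M. \<forall>g\<in>carrier G. \<forall>h\<in>carrier G. act (act m g) h = act m (g \<otimes>\<^bsub>G\<^esub> h))"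

definition right_module ::
    "('g, 'x) monoid_scheme \<Rightarrow> ('m, 'y) monoid_scheme \<Rightarrow> ('m \<Rightarrow> 'g \<Rightarrow> 'm) \<Rightarrow> bool" where
  "right_module G M act \<longleftrightarrow> group G \<and> comm_group M \<and> right_action G M act"

definition free_module_on ::
    "'t itself \<Rightarrow> ('g, 'x) monoid_scheme \<Rightarrow> 'm monoid \<Rightarrow> ('m \<Rightarrow> 'g \<Rightarrow> 'm) \<Rightarrow>
     's set \<Rightarrow> ('s \<Rightarrow> 'm) \<Rightarrow> bool" where
  "free_module_on T G M act S \<iota> \<longleftrightarrow>
     right_module G M act \<and> \<iota> \<in> S \<rightarrow> carrier M \<and>
     (\<forall>(N :: 't monoid) actN f. right_module G N actN \<longrightarrow> f \<in> S \<rightarrow> carrier N \<longrightarrow>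
        (\<exists>!k. k \<in> hom M N \<and> k \<in> extensional (carrier M) \<and>
              (\<forall>m\<in>carrier M. \<forall>g\<in>carrier G. k (act m g) = actN (k m) g) \<and>
              (\<forall>s\<in>S. k (\<iota> s) = f s)))"

definition crossed_module ::
    "('f, 'x) monoid_scheme \<Rightarrow> ('m, 'y) monoid_scheme \<Rightarrow> ('m \<Rightarrow> 'f \<Rightarrow> 'm) \<Rightarrow> ('m \<Rightarrow> 'f) \<Rightarrow> bool" where
  "crossed_module F M act \<mu> \<longleftrightarrow>
     group F \<and> group M \<and> right_action F M act \<and> \<mu> \<in> hom M F \<and>
     (\<forall>m\<in>carrier M. \<forall>u\<in>carrier F. \<mu> (act m u) = inv\<^bsub>F\<^esub> u \<otimes>\<^bsub>F\<^esub> \<mu> m \<otimes>\<^bsub>F\<^esub> u) \<and>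
     (\<forall>m\<in>carrier M. \<forall>n\<in>carrier M. inv\<^bsub>M\<^esub> n \<otimes>\<^bsub>M\<^esub> m \<otimes>\<^bsub>M\<^esub> n = act m (\<mu> n))"

definition free_crossed_module_on ::
    "'t itself \<Rightarrow> ('f, 'x) monoid_scheme \<Rightarrow> 's set \<Rightarrow> ('s \<Rightarrow> 'f) \<Rightarrow>
     'm monoid \<Rightarrow> ('m \<Rightarrow> 'f \<Rightarrow> 'm) \<Rightarrow> ('m \<Rightarrow> 'f) \<Rightarrow> ('s \<Rightarrow> 'm) \<Rightarrow> bool" where
  "free_crossed_module_on T F S w M act \<mu> \<iota> \<longleftrightarrow>
     crossed_module F M act \<mu> \<and> \<iota> \<in> S \<rightarrow> carrier M \<and> (\<forall>s\<in>S. \<mu> (\<iota> s) = w s) \<and>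
     (\<forall>(N :: 't monoid) actN \<nu> f.
        crossed_module F N actN \<nu> \<longrightarrow> f \<in> S \<rightarrow> carrier N \<longrightarrow> (\<forall>s\<in>S. \<nu> (f s) = w s) \<longrightarrow>
        (\<exists>!k. k \<in> hom M N \<and> k \<in> extensional (carrier M) \<and>
              (\<forall>m\<in>carrier M. \<nu> (k m) = \<mu> m) \<and>
              (\<forall>m\<in>carrier M. \<forall>u\<in>carrier F. k (act m u) = actN (k m) u) \<and>
              (\<forall>s\<in>S. k (\<iota> s) = f s)))"


section \<open>Free crossed resolutions\<close>

text \<open>Only the values \<open>Cn n\<close>, \<open>actn n\<close> with \<open>n \<ge> 3\<close> and \<open>dn n\<close> with \<open>n \<ge> 4\<close> are meaningful.\<close>

record ('g, 'f, 'm, 'c) crossed_data =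
  C1 :: "'f monoid"
  phi :: "'f \<Rightarrow> 'g"
  C2 :: "'m monoid"
  act2 :: "'m \<Rightarrow> 'f \<Rightarrow> 'm"
  d2 :: "'m \<Rightarrow> 'f"
  Cn :: "nat \<Rightarrow> 'c monoid"
  actn :: "nat \<Rightarrow> 'c \<Rightarrow> 'g \<Rightarrow> 'c"
  d3 :: "'c \<Rightarrow> 'm"
  dn :: "nat \<Rightarrow> 'c \<Rightarrow> 'c"

text \<open>
  \<open>R\<close> is a free crossed resolution of \<open>G\<close>, free on \<open>\<iota>\<^sub>1 : B1 \<rightarrow> C\<^sub>1\<close>, \<open>\<iota>\<^sub>2 : B2 \<rightarrow> C\<^sub>2\<close> and
  \<open>\<iota>\<^sub>n : B n \<rightarrow> C\<^sub>n\<close> for \<open>n \<ge> 3\<close>.  Equivariance of \<open>\<delta>\<^sub>3\<close> is expressed through \<open>C\<^sub>1\<close>, since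
  \<open>G\<close> acts on \<open>ker \<delta>\<^sub>2\<close> by lifting its elements along \<open>\<phi>\<close>.
\<close>

definition free_crossed_resolution_on ::
    "'t itself \<Rightarrow> ('g, 'x) monoid_scheme \<Rightarrow> ('g, 'f, 'm, 'c) crossed_data \<Rightarrow>
     'r set \<Rightarrow> ('r \<Rightarrow> 'f) \<Rightarrow> 's set \<Rightarrow> ('s \<Rightarrow> 'm) \<Rightarrow> (nat \<Rightarrow> 'b set) \<Rightarrow> (nat \<Rightarrow> 'b \<Rightarrow> 'c) \<Rightarrow> bool" where
  "free_crossed_resolution_on T G R B1 \<iota>1 B2 \<iota>2 B \<iota> \<longleftrightarrow>
     group G \<and>
     free_group_on T (C1 R) B1 \<iota>1 \<and>
     phi R \<in> hom (C1 R) G \<and> phi R ` carrier (C1 R) = carrier G \<and>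
     free_crossed_module_on T (C1 R) B2 (\<lambda>s. d2 R (\<iota>2 s)) (C2 R) (act2 R) (d2 R) \<iota>2 \<and>
     d2 R ` carrier (C2 R) = kernel (C1 R) G (phi R) \<and>
     (\<forall>n\<ge>3. free_module_on T G (Cn R n) (actn R n) (B n) (\<iota> n)) \<and>
     d3 R \<in> hom (Cn R 3) (C2 R) \<and>
     (\<forall>c\<in>carrier (Cn R 3). \<forall>u\<in>carrier (C1 R). d3 R (actn R 3 c (phi R u)) = act2 R (d3 R c) u) \<and>
     (\<forall>n\<ge>4. dn R n \<in> hom (Cn R n) (Cn R (n - 1)) \<and>
            (\<forall>c\<in>carrier (Cn R n). \<forall>g\<in>carrier G.
               dn R n (actn R n c g) = actn R (n - 1) (dn R n c) g)) \<and>
     kernel (C2 R) (C1 R) (d2 R) = d3 R ` carrier (Cn R 3) \<and>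
     kernel (Cn R 3) (C2 R) (d3 R) = dn R 4 ` carrier (Cn R 4) \<and>
     (\<forall>n\<ge>4. kernel (Cn R n) (Cn R (n - 1)) (dn R n) = dn R (n + 1) ` carrier (Cn R (n + 1)))"


section \<open>The universal cover and its contracting homotopies\<close>

definition cov_arrows :: "('g, 'x) monoid_scheme \<Rightarrow> ('g, 'f, 'm, 'c) crossed_data \<Rightarrow> ('g \<times> 'f) set" where
  "cov_arrows G R = carrier G \<times> carrier (C1 R)"

definition cov_source :: "'g \<times> 'f \<Rightarrow> 'g" where
  "cov_source a = fst a"

definition cov_target ::
    "('g, 'x) monoid_scheme \<Rightarrow> ('g, 'f, 'm, 'c) crossed_data \<Rightarrow> 'g \<times> 'f \<Rightarrow> 'g" where
  "cov_target G R a = fst a \<otimes>\<^bsub>G\<^esub> phi R (snd a)"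

definition cov_comp :: "('g, 'f, 'm, 'c) crossed_data \<Rightarrow> 'g \<times> 'f \<Rightarrow> 'g \<times> 'f \<Rightarrow> 'g \<times> 'f" where
  "cov_comp R a b = (fst a, snd a \<otimes>\<^bsub>C1 R\<^esub> snd b)"

definition cov_inv ::
    "('g, 'x) monoid_scheme \<Rightarrow> ('g, 'f, 'm, 'c) crossed_data \<Rightarrow> 'g \<times> 'f \<Rightarrow> 'g \<times> 'f" where
  "cov_inv G R a = (cov_target G R a, inv\<^bsub>C1 R\<^esub> (snd a))"

definition fibre :: "'c monoid \<Rightarrow> 'g \<Rightarrow> ('g \<times> 'c) monoid" where
  "fibre M g = \<lparr>carrier = {g} \<times> carrier M, monoid.mult = (\<lambda>x y. (g, snd x \<otimes>\<^bsub>M\<^esub> snd y)), one = (g, \<one>\<^bsub>M\<^esub>)\<rparr>"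

definition cov_map :: "('c \<Rightarrow> 'd) \<Rightarrow> 'g \<times> 'c \<Rightarrow> 'g \<times> 'd" where
  "cov_map d x = (fst x, d (snd x))"

text \<open>In the two actions the arrow \<open>a\<close> is assumed to start at the base point \<open>fst x\<close> of \<open>x\<close>.\<close>

definition cov_act2 ::
    "('g, 'x) monoid_scheme \<Rightarrow> ('g, 'f, 'm, 'c) crossed_data \<Rightarrow> 'g \<times> 'm \<Rightarrow> 'g \<times> 'f \<Rightarrow> 'g \<times> 'm" where
  "cov_act2 G R x a = (cov_target G R a, act2 R (snd x) (snd a))"

definition cov_act ::
    "('g, 'x) monoid_scheme \<Rightarrow> ('g, 'f, 'm, 'c) crossed_data \<Rightarrow> nat \<Rightarrow>
     'g \<times> 'c \<Rightarrow> 'g \<times> 'f \<Rightarrow> 'g \<times> 'c" where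
  "cov_act G R n x a = (cov_target G R a, actn R n (snd x) (phi R (snd a)))"

definition contracting_homotopy ::
    "('g, 'x) monoid_scheme \<Rightarrow> ('g, 'f, 'm, 'c) crossed_data \<Rightarrow>
     ('g \<Rightarrow> 'g \<times> 'f) \<Rightarrow> ('g \<times> 'f \<Rightarrow> 'g \<times> 'm) \<Rightarrow> ('g \<times> 'm \<Rightarrow> 'g \<times> 'c) \<Rightarrow>
     (nat \<Rightarrow> 'g \<times> 'c \<Rightarrow> 'g \<times> 'c) \<Rightarrow> bool" where
  "contracting_homotopy G R h0 h1 h2 h \<longleftrightarrow>
     (\<forall>g\<in>carrier G. h0 g \<in> cov_arrows G R \<and> cov_source (h0 g) = g \<and> cov_target G R (h0 g) = \<one>\<^bsub>G\<^esub>) \<and>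
     (\<forall>a\<in>cov_arrows G R. h1 a \<in> carrier (fibre (C2 R) \<one>\<^bsub>G\<^esub>)) \<and>
     (\<forall>a\<in>cov_arrows G R. \<forall>b\<in>cov_arrows G R. cov_target G R a = cov_source b \<longrightarrow>
        h1 (cov_comp R a b) = h1 a \<otimes>\<^bsub>fibre (C2 R) \<one>\<^bsub>G\<^esub>\<^esub> h1 b) \<and>
     (\<forall>g\<in>carrier G. h2 \<in> hom (fibre (C2 R) g) (fibre (Cn R 3) \<one>\<^bsub>G\<^esub>)) \<and>
     (\<forall>g\<in>carrier G. \<forall>x\<in>carrier (fibre (C2 R) g). \<forall>a\<in>cov_arrows G R. cov_source a = g \<longrightarrow>
        h2 (cov_act2 G R x a) = h2 x) \<and>
     (\<forall>n\<ge>3. \<forall>g\<in>carrier G. h n \<in> hom (fibre (Cn R n) g) (fibre (Cn R (n + 1)) \<one>\<^bsub>G\<^esub>)) \<and>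
     (\<forall>n\<ge>3. \<forall>g\<in>carrier G. \<forall>x\<in>carrier (fibre (Cn R n) g). \<forall>a\<in>cov_arrows G R. cov_source a = g \<longrightarrow>
        h n (cov_act G R n x a) = h n x) \<and>
     (\<forall>a\<in>cov_arrows G R.
        cov_map (d2 R) (h1 a) =
          cov_comp R (cov_comp R (cov_inv G R (h0 (cov_source a))) a) (h0 (cov_target G R a))) \<and>
     (\<forall>g\<in>carrier G. \<forall>x\<in>carrier (fibre (C2 R) g).
        cov_map (d3 R) (h2 x) =
          inv\<^bsub>fibre (C2 R) \<one>\<^bsub>G\<^esub>\<^esub> (h1 (cov_map (d2 R) x)) \<otimes>\<^bsub>fibre (C2 R) \<one>\<^bsub>G\<^esub>\<^esub> cov_act2 G R x (h0 g)) \<and>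
     (\<forall>g\<in>carrier G. \<forall>x\<in>carrier (fibre (Cn R 3) g).
        cov_map (dn R 4) (h 3 x) =
          inv\<^bsub>fibre (Cn R 3) \<one>\<^bsub>G\<^esub>\<^esub> (h2 (cov_map (d3 R) x)) \<otimes>\<^bsub>fibre (Cn R 3) \<one>\<^bsub>G\<^esub>\<^esub> cov_act G R 3 x (h0 g)) \<and>
     (\<forall>n\<ge>4. \<forall>g\<in>carrier G. \<forall>x\<in>carrier (fibre (Cn R n) g).
        cov_map (dn R (n + 1)) (h n x) =
          inv\<^bsub>fibre (Cn R n) \<one>\<^bsub>G\<^esub>\<^esub> (h (n - 1) (cov_map (dn R n) x)) \<otimes>\<^bsub>fibre (Cn R n) \<one>\<^bsub>G\<^esub>\<^esub> cov_act G R n x (h0 g))"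


section \<open>Concrete free objects\<close>

subsection \<open>Free groups: reduced words, \<open>(True, s)\<close> standing for \<open>s\<close> and \<open>(False, s)\<close> for its inverse\<close>

type_synonym 's word = "(bool \<times> 's) list"

definition cancelling :: "bool \<times> 's \<Rightarrow> bool \<times> 's \<Rightarrow> bool" where
  "cancelling x y \<longleftrightarrow> snd x = snd y \<and> fst x \<noteq> fst y"

fun push_letter :: "bool \<times> 's \<Rightarrow> 's word \<Rightarrow> 's word" where
  "push_letter x [] = [x]"
| "push_letter x (y # v) = (if cancelling x y then v else x # y # v)"

definition free_group :: "'s set \<Rightarrow> 's word monoid" where
  "free_group S =
     \<lparr>carrier = {v. snd ` set v \<subseteq> S \<and> successively (\<lambda>x y. \<not> cancelling x y) v},
      monoid.mult = (\<lambda>u v. foldr push_letter u v), one = []\<rparr>"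

definition letter :: "'s \<Rightarrow> 's word" where
  "letter s = [(True, s)]"

definition eval_word :: "('h, 'x) monoid_scheme \<Rightarrow> ('s \<Rightarrow> 'h) \<Rightarrow> 's word \<Rightarrow> 'h" where
  "eval_word H f v = foldr (\<lambda>(e, s) r. (if e then f s else inv\<^bsub>H\<^esub> (f s)) \<otimes>\<^bsub>H\<^esub> r) v \<one>\<^bsub>H\<^esub>"

subsection \<open>Free crossed modules: words in the formal symbols \<open>(s, u) = s\<^sup>u\<close> modulo the Peiffer relations\<close>

definition pre_group :: "('f, 'x) monoid_scheme \<Rightarrow> 's set \<Rightarrow> ('s \<times> 'f) word monoid" where
  "pre_group F S = free_group (S \<times> carrier F)"

definition pre_act :: "('f, 'x) monoid_scheme \<Rightarrow> ('s \<times> 'f) word \<Rightarrow> 'f \<Rightarrow> ('s \<times> 'f) word" where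
  "pre_act F p v = map (\<lambda>(e, s, u). (e, s, u \<otimes>\<^bsub>F\<^esub> v)) p"

definition pre_bd :: "('f, 'x) monoid_scheme \<Rightarrow> ('s \<Rightarrow> 'f) \<Rightarrow> ('s \<times> 'f) word \<Rightarrow> 'f" where
  "pre_bd F w = eval_word F (\<lambda>(s, u). inv\<^bsub>F\<^esub> u \<otimes>\<^bsub>F\<^esub> w s \<otimes>\<^bsub>F\<^esub> u)"

definition peiffer_subgroup ::
    "('f, 'x) monoid_scheme \<Rightarrow> 's set \<Rightarrow> ('s \<Rightarrow> 'f) \<Rightarrow> ('s \<times> 'f) word set" where
  "peiffer_subgroup F S w = (let P = pre_group F S in
     \<Inter>{N. N \<lhd> P \<and>
         (\<forall>p\<in>carrier P. \<forall>q\<in>carrier P.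
            inv\<^bsub>P\<^esub> p \<otimes>\<^bsub>P\<^esub> q \<otimes>\<^bsub>P\<^esub> p \<otimes>\<^bsub>P\<^esub> inv\<^bsub>P\<^esub> (pre_act F q (pre_bd F w p)) \<in> N)})"

definition free_xmod ::
    "('f, 'x) monoid_scheme \<Rightarrow> 's set \<Rightarrow> ('s \<Rightarrow> 'f) \<Rightarrow> ('s \<times> 'f) word set monoid" where
  "free_xmod F S w = pre_group F S Mod peiffer_subgroup F S w"

definition free_xmod_act ::
    "('f, 'x) monoid_scheme \<Rightarrow> ('s \<times> 'f) word set \<Rightarrow> 'f \<Rightarrow> ('s \<times> 'f) word set" where
  "free_xmod_act F K v = (\<lambda>p. pre_act F p v) ` K"

definition free_xmod_bd ::
    "('f, 'x) monoid_scheme \<Rightarrow> ('s \<Rightarrow> 'f) \<Rightarrow> ('s \<times> 'f) word set \<Rightarrow> 'f" where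
  "free_xmod_bd F w K = the_elem (pre_bd F w ` K)"

definition free_xmod_gen ::
    "('f, 'x) monoid_scheme \<Rightarrow> 's set \<Rightarrow> ('s \<Rightarrow> 'f) \<Rightarrow> 's \<Rightarrow> ('s \<times> 'f) word set" where
  "free_xmod_gen F S w s = peiffer_subgroup F S w #>\<^bsub>pre_group F S\<^esub> letter (s, \<one>\<^bsub>F\<^esub>)"

subsection \<open>Free right modules: integer combinations of the formal symbols \<open>(s, g) = s\<^sup>g\<close>\<close>

definition free_mod :: "('g, 'x) monoid_scheme \<Rightarrow> 's set \<Rightarrow> ('s \<times> 'g \<Rightarrow>\<^sub>0 int) monoid" where
  "free_mod G S = free_Abelian_group (S \<times> carrier G)"

definition free_mod_act ::
    "('g, 'x) monoid_scheme \<Rightarrow> ('s \<times> 'g \<Rightarrow>\<^sub>0 int) \<Rightarrow> 'g \<Rightarrow> ('s \<times> 'g \<Rightarrow>\<^sub>0 int)" where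
  "free_mod_act G c h = frag_extend (\<lambda>(s, g). frag_of (s, g \<otimes>\<^bsub>G\<^esub> h)) c"

definition free_mod_gen :: "('g, 'x) monoid_scheme \<Rightarrow> 's \<Rightarrow> ('s \<times> 'g \<Rightarrow>\<^sub>0 int)" where
  "free_mod_gen G s = frag_of (s, \<one>\<^bsub>G\<^esub>)"


section \<open>The standard crossed resolution\<close>

text \<open>Generators are indexed by \<open>a\<close>, by \<open>(a, b)\<close>, and in dimension \<open>n \<ge> 3\<close> by lists of length \<open>n\<close>.\<close>

definition tuples :: "('g, 'x) monoid_scheme \<Rightarrow> nat \<Rightarrow> 'g list set" where
  "tuples G n = {xs. length xs = n \<and> set xs \<subseteq> carrier G}"

definition std_C1 :: "('g, 'x) monoid_scheme \<Rightarrow> 'g word monoid" where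
  "std_C1 G = free_group (carrier G)"

definition std_relator :: "('g, 'x) monoid_scheme \<Rightarrow> 'g \<times> 'g \<Rightarrow> 'g word" where
  "std_relator G = (\<lambda>(a, b). letter a \<otimes>\<^bsub>std_C1 G\<^esub> letter b \<otimes>\<^bsub>std_C1 G\<^esub> inv\<^bsub>std_C1 G\<^esub> (letter (a \<otimes>\<^bsub>G\<^esub> b)))"

type_synonym 'g std1 = "'g word"
type_synonym 'g std2 = "(('g \<times> 'g) \<times> 'g word) word set"
type_synonym 'g stdn = "'g list \<times> 'g \<Rightarrow>\<^sub>0 int"

definition br1 :: "'g \<Rightarrow> 'g std1" where
  "br1 = letter"

definition br2 :: "('g, 'x) monoid_scheme \<Rightarrow> 'g \<times> 'g \<Rightarrow> 'g std2" where
  "br2 G = free_xmod_gen (std_C1 G) (carrier G \<times> carrier G) (std_relator G)"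

definition br :: "('g, 'x) monoid_scheme \<Rightarrow> 'g list \<Rightarrow> 'g stdn" where
  "br G = free_mod_gen G"

definition standard_crossed_data ::
    "('g, 'x) monoid_scheme \<Rightarrow> ('g stdn \<Rightarrow> 'g std2) \<Rightarrow> (nat \<Rightarrow> 'g stdn \<Rightarrow> 'g stdn) \<Rightarrow>
     ('g, 'g std1, 'g std2, 'g stdn) crossed_data" where
  "standard_crossed_data G \<delta>\<^sub>3 \<delta> =
     \<lparr>C1 = std_C1 G,
      phi = eval_word G (\<lambda>a. a),
      C2 = free_xmod (std_C1 G) (carrier G \<times> carrier G) (std_relator G),
      act2 = free_xmod_act (std_C1 G),
      d2 = free_xmod_bd (std_C1 G) (std_relator G),
      Cn = (\<lambda>n. free_mod G (tuples G n)),
      actn = (\<lambda>n. free_mod_act G),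
      d3 = \<delta>\<^sub>3,
      dn = \<delta>\<rparr>"


section \<open>The section in dimension zero\<close>

text \<open>
  The standard homotopy has \<open>h\<^sub>0 a = (a, \<sigma>(a)\<^sup>-\<^sup>1)\<close> with \<open>\<sigma>(a) = [a]\<close> for every \<open>a\<close>, including
  \<open>\<sigma>(1) = [1]\<close>.  Normalising \<open>\<sigma>(1) = 1\<close> is incompatible with the formulas for \<open>h\<^sub>1\<close> and \<open>\<delta>\<^sub>2\<close>
  as soon as \<open>G\<close> has an element \<open>a \<noteq> 1\<close>: it forces the free generator \<open>[1]\<close> to be trivial.
\<close>

lemma normalised_section_forces_trivial_generator:
  fixes R :: "('g, 'f, 'm, 'c) crossed_data" and b1 :: "'g \<Rightarrow> 'f" and b2 :: "'g \<times> 'g \<Rightarrow> 'm"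
  assumes G: "group G" and F: "group (C1 R)"
    and b1: "b1 \<in> carrier G \<rightarrow> carrier (C1 R)"
    and phi: "\<And>a. a \<in> carrier G \<Longrightarrow> phi R (b1 a) = a"
    and d2: "\<And>a b. a \<in> carrier G \<Longrightarrow> b \<in> carrier G \<Longrightarrow>
      d2 R (b2 (a, b)) = b1 a \<otimes>\<^bsub>C1 R\<^esub> b1 b \<otimes>\<^bsub>C1 R\<^esub> inv\<^bsub>C1 R\<^esub> (b1 (a \<otimes>\<^bsub>G\<^esub> b))"
    and ch: "contracting_homotopy G R h0 h1 h2 h"
    and h1: "\<And>a b. a \<in> carrier G \<Longrightarrow> b \<in> carrier G \<Longrightarrow> h1 (a, b1 b) = (\<one>\<^bsub>G\<^esub>, b2 (a, b))"
    and h0: "\<And>a. a \<in> carrier G \<Longrightarrow>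
      h0 a = (a, inv\<^bsub>C1 R\<^esub> (if a = \<one>\<^bsub>G\<^esub> then \<one>\<^bsub>C1 R\<^esub> else b1 a))"
    and a: "a \<in> carrier G" "a \<noteq> \<one>\<^bsub>G\<^esub>"
  shows "b1 \<one>\<^bsub>G\<^esub> = \<one>\<^bsub>C1 R\<^esub>"
proof -
  interpret G: group G by (fact G)
  interpret F: group "C1 R" by (fact F)
  have mem: "b1 a \<in> carrier (C1 R)" "b1 \<one>\<^bsub>G\<^esub> \<in> carrier (C1 R)"
    using b1 a by auto
  then have arr: "(\<one>\<^bsub>G\<^esub>, b1 a) \<in> cov_arrows G R"
    by (simp add: cov_arrows_def)
  have "cov_map (d2 R) (h1 (\<one>\<^bsub>G\<^esub>, b1 a)) =
      cov_comp R (cov_comp R (cov_inv G R (h0 (cov_source (\<one>\<^bsub>G\<^esub>, b1 a)))) (\<one>\<^bsub>G\<^esub>, b1 a))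
        (h0 (cov_target G R (\<one>\<^bsub>G\<^esub>, b1 a)))"
    using ch arr unfolding contracting_homotopy_def by blast
  then show ?thesis
    using a mem
    by (simp add: h1 d2 h0 phi cov_map_def cov_comp_def cov_inv_def cov_source_def cov_target_def
        F.m_assoc)
qed

end

(* A free crossed resolution is exact as soon as its universal cover carries a contracting homotopy
   h, so it is enough to make h and the boundaries determine each other.  On the universal cover
   each h_n is forced by its values on generators: h_1 is a derivation-like function on words, and
   h_n (n >= 2) is invariant under the groupoid action, hence sends (g, [xs]^k) to
   [g k^-1, xs].  The right-hand side m |-> (h_1 d_2 m)^-1 m^(h_0 g) of the identity for d_3 h_2
   takes values in the central subgroup ker d_2; this makes it a homomorphism, invariant under the
   groupoid, so that it defines d_3 on generators.  In higher dimensions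
   d_(n+1) [a, xs] = [xs]^(a^-1) - h_(n-1) (a, d_n [xs]) is both the homotopy identity and a
   recursion from which d d = 0 follows by induction. *)
theory Submission
  imports Defs
begin

section \<open>Free groups\<close>

text \<open>The obstacle sits in dimension 2, where \<open>C_2\<close> is not abelian in general and
  only \<open>ker bd\<close> carries an action of \<open>G\<close>. A map \<open>delta_3\<close> has
  to land in \<open>ker bd\<close> and to respect every lift along \<phi>, so the equality of the
  image of \<open>bd\<close> with the kernel of \<phi>, and the \<open>G\<close>-module structure of
  \<open>ker bd\<close> that it gives, must be in place before \<open>delta_3\<close> is defined.
  Both come from a single telescoping identity, \<open>bd_cov_val\<close>. Keeping
  \<open>letter \<one>\<close> as a genuine generator spares all case distinctions at the unit. The
  price is that \<open>h_0\<close> at the base point is the arrow labelled \<open>[1]^-1\<close> and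
  not an identity. This is harmless: in \<open>F\<close> a conjugation by \<open>[1]\<close> undoes
  it, and on \<open>ker bd\<close> only the image in \<open>G\<close> matters. The homotopy alone
  puts kernels inside images. For the converse the induction has to start from the multiplicative
  \<open>delta_3\<close>, although the higher boundaries are alternating sums. The two are linked
  through \<open>h_2\<close>: its values lie in an abelian group, so it does not see the order of
  the factors of \<open>delta_3\<close>.\<close>

abbreviation reduced :: "'s word \<Rightarrow> bool" where
  "reduced v \<equiv> successively (\<lambda>x y. \<not> cancelling x y) v"

definition letter_val :: "('h, 'x) monoid_scheme \<Rightarrow> ('s \<Rightarrow> 'h) \<Rightarrow> bool \<times> 's \<Rightarrow> 'h" where
  "letter_val H f x = (if fst x then f (snd x) else inv\<^bsub>H\<^esub> (f (snd x)))"

lemma eval_word_Nil [simp]: "eval_word H f [] = \<one>\<^bsub>H\<^esub>"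
  by (simp add: eval_word_def)

lemma eval_word_Cons [simp]: "eval_word H f (x # v) = letter_val H f x \<otimes>\<^bsub>H\<^esub> eval_word H f v"
  by (cases x) (simp add: eval_word_def letter_val_def)

section \<open>Reduced words form a group\<close>

lemma reduced_push_letter: "reduced v \<Longrightarrow> reduced (push_letter x v)"
  by (cases v) (auto simp: successively_Cons)

text \<open>If \<open>y\<close> cancels the head of \<open>v\<close>, that head equals
  \<open>x\<close>, because a sign has only two values. As \<open>v\<close> is reduced,
  \<open>x\<close> does not cancel against the remaining word, so pushing it restores
  \<open>v\<close>.\<close>

lemma push_letter_cancel:
  assumes "reduced v" "cancelling x y"
  shows "push_letter x (push_letter y v) = v"
proof (cases v)
  case (Cons z v')
  then show ?thesis
    using assms by (cases v') (auto simp: cancelling_def prod_eq_iff)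
qed (use assms in \<open>auto simp: cancelling_def\<close>)

lemma reduced_foldr_push_letter: "reduced v \<Longrightarrow> reduced (foldr push_letter u v)"
  by (induction u) (auto simp: reduced_push_letter)

text \<open>Van der Waerden's argument: letters act on reduced words by \<open>push_letter\<close>,
  and cancelling letters act as mutually inverse maps. A product therefore acts as the composite of
  its factors, which is associativity.\<close>

lemma foldr_push_letter_push:
  assumes "reduced u" "reduced w"
  shows "foldr push_letter (push_letter x u) w = push_letter x (foldr push_letter u w)"
proof (cases u)
  case (Cons y v)
  then show ?thesis
    using assms push_letter_cancel[OF reduced_foldr_push_letter[OF assms(2)]]
    by (auto simp: successively_Cons)
qed simp

lemma foldr_push_letter_assoc:
  assumes "reduced v" "reduced w"
  shows "foldr push_letter (foldr push_letter u v) w = foldr push_letter u (foldr push_letter v w)"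
  using assms by (induction u) (auto simp: foldr_push_letter_push reduced_foldr_push_letter)

lemma push_letter_reduced: "reduced (x # v) \<Longrightarrow> push_letter x v = x # v"
  by (cases v) auto

lemma set_push_letter: "set (push_letter x v) \<subseteq> insert x (set v)"
  by (cases v) auto

lemma set_foldr_push_letter: "set (foldr push_letter u v) \<subseteq> set u \<union> set v"
  using set_push_letter by (induction u) fastforce+

definition inv_letter :: "bool \<times> 's \<Rightarrow> bool \<times> 's" where
  "inv_letter x = (\<not> fst x, snd x)"

lemma foldr_push_letter_inv_word:
  assumes "reduced v"
  shows "foldr push_letter (rev (map inv_letter v)) v = []"
  using assms
proof (induction v)
  case (Cons x v)
  then have "push_letter (inv_letter x) (x # v) = v" "reduced v"
    by (auto simp: inv_letter_def cancelling_def successively_Cons)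
  then show ?case
    using Cons.IH by (simp del: push_letter.simps)
qed simp

lemma carrier_free_group: "v \<in> carrier (free_group S) \<longleftrightarrow> snd ` set v \<subseteq> S \<and> reduced v"
  by (simp add: free_group_def)

lemma mult_free_group: "u \<otimes>\<^bsub>free_group S\<^esub> v = foldr push_letter u v"
  by (simp add: free_group_def)

lemma one_free_group: "\<one>\<^bsub>free_group S\<^esub> = []"
  by (simp add: free_group_def)

lemma group_free_group: "group (free_group S)"
proof (rule groupI)
  fix u v assume "u \<in> carrier (free_group S)" "v \<in> carrier (free_group S)"
  then show "u \<otimes>\<^bsub>free_group S\<^esub> v \<in> carrier (free_group S)"
    using set_foldr_push_letter[of u v]
    by (fastforce simp: carrier_free_group mult_free_group reduced_foldr_push_letter)
next
  fix u assume u: "u \<in> carrier (free_group S)"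
  \<comment> \<open>Pushing the reversed inverse letters onto the empty word yields a reduced word
    by construction, so reducedness of the reversed word itself need not be examined.\<close>
  define u' where "u' = foldr push_letter (rev (map inv_letter u)) []"
  have "snd ` set u' \<subseteq> S"
    using u set_foldr_push_letter[of "rev (map inv_letter u)" "[]"]
    unfolding u'_def carrier_free_group by (fastforce simp: inv_letter_def)
  then have "u' \<in> carrier (free_group S)"
    by (simp add: carrier_free_group u'_def reduced_foldr_push_letter)
  moreover have "u' \<otimes>\<^bsub>free_group S\<^esub> u = \<one>\<^bsub>free_group S\<^esub>"
    using u unfolding u'_def
    by (simp add: mult_free_group one_free_group carrier_free_group foldr_push_letter_assoc
        foldr_push_letter_inv_word)
  ultimately show "\<exists>y\<in>carrier (free_group S). y \<otimes>\<^bsub>free_group S\<^esub> u = \<one>\<^bsub>free_group S\<^esub>"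
    by blast
qed (auto simp: carrier_free_group mult_free_group one_free_group foldr_push_letter_assoc)

lemma letter_closed: "s \<in> S \<Longrightarrow> letter s \<in> carrier (free_group S)"
  by (simp add: carrier_free_group letter_def)

lemma inv_letter_word:
  assumes "s \<in> S"
  shows "inv\<^bsub>free_group S\<^esub> (letter s) = [(False, s)]"
  by (rule group.inv_equality[OF group_free_group])
    (use assms in \<open>auto simp: mult_free_group one_free_group letter_def cancelling_def carrier_free_group\<close>)

text \<open>No cancellation occurs at the join of a reduced word \<open>x # v\<close>, so it is the
  product of a one-letter word and \<open>v\<close>; list induction thus becomes induction by left
  multiplication with generators and their inverses.\<close>

lemma free_group_induct [consumes 1, case_names one letter inv_letter]:
  assumes "v \<in> carrier (free_group S)"
    and "P \<one>\<^bsub>free_group S\<^esub>"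
    and "\<And>s v. s \<in> S \<Longrightarrow> v \<in> carrier (free_group S) \<Longrightarrow> P v \<Longrightarrow> P (letter s \<otimes>\<^bsub>free_group S\<^esub> v)"
    and "\<And>s v. s \<in> S \<Longrightarrow> v \<in> carrier (free_group S) \<Longrightarrow> P v \<Longrightarrow>
           P (inv\<^bsub>free_group S\<^esub> (letter s) \<otimes>\<^bsub>free_group S\<^esub> v)"
  shows "P v"
  using assms(1)
proof (induction v)
  case Nil
  then show ?case
    using assms(2) by (simp add: one_free_group)
next
  case (Cons x v)
  then have v: "v \<in> carrier (free_group S)" "P v" "snd x \<in> S" "reduced (x # v)"
    by (auto simp: carrier_free_group successively_Cons)
  then have "x # v = [x] \<otimes>\<^bsub>free_group S\<^esub> v"
    by (simp add: mult_free_group push_letter_reduced)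
  moreover have "[x] = letter (snd x) \<or> [x] = inv\<^bsub>free_group S\<^esub> (letter (snd x))"
    using inv_letter_word[OF v(3)] by (cases x; cases "fst x") (auto simp: letter_def)
  ultimately show ?case
    using assms(3,4)[OF v(3) v(1) v(2)] by metis
qed

section \<open>Evaluation of words and the universal property of free groups\<close>

lemma (in group) letter_val_closed:
  "f \<in> S \<rightarrow> carrier G \<Longrightarrow> snd x \<in> S \<Longrightarrow> letter_val G f x \<in> carrier G"
  by (auto simp: letter_val_def)

lemma (in group) eval_word_closed:
  "f \<in> S \<rightarrow> carrier G \<Longrightarrow> snd ` set v \<subseteq> S \<Longrightarrow> eval_word G f v \<in> carrier G"
  by (induction v) (auto simp: letter_val_closed[of f S])

lemma (in group) eval_word_push_letter:
  assumes "f \<in> S \<rightarrow> carrier G" "snd x \<in> S" "snd ` set v \<subseteq> S"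
  shows "eval_word G f (push_letter x v) = letter_val G f x \<otimes> eval_word G f v"
proof (cases v)
  case (Cons y v')
  have [simp]: "eval_word G f v' \<in> carrier G" "f (snd x) \<in> carrier G"
    using assms Cons by (auto intro: eval_word_closed)
  have "letter_val G f x \<otimes> (letter_val G f y \<otimes> eval_word G f v') = eval_word G f v'"
    if "cancelling x y"
    using that \<open>f (snd x) \<in> carrier G\<close>
    by (auto simp: cancelling_def letter_val_def m_assoc[symmetric])
  with Cons show ?thesis by simp
qed simp

lemma (in group) eval_word_foldr_push_letter:
  assumes "f \<in> S \<rightarrow> carrier G" "snd ` set u \<subseteq> S" "snd ` set v \<subseteq> S"
  shows "eval_word G f (foldr push_letter u v) = eval_word G f u \<otimes> eval_word G f v"
  using assms(2)
proof (induction u)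
  case (Cons x u)
  have "snd ` set (foldr push_letter u v) \<subseteq> S"
    using Cons.prems assms(3) set_foldr_push_letter[of u v] by fastforce
  then have "eval_word G f (push_letter x (foldr push_letter u v)) =
      letter_val G f x \<otimes> eval_word G f (foldr push_letter u v)"
    using Cons.prems by (intro eval_word_push_letter[OF assms(1)]) auto
  moreover have "letter_val G f x \<in> carrier G" "eval_word G f u \<in> carrier G"
    "eval_word G f v \<in> carrier G"
    using Cons.prems assms by (auto intro: letter_val_closed eval_word_closed)
  ultimately show ?case
    using Cons by (simp add: m_assoc)
qed (use assms in \<open>simp add: eval_word_closed[of f S]\<close>)

lemma (in group) eval_word_hom:
  assumes "f \<in> S \<rightarrow> carrier G"
  shows "eval_word G f \<in> hom (free_group S) G"
  using assms
  by (intro homI) (auto simp: carrier_free_group mult_free_group eval_word_closed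
      eval_word_foldr_push_letter[OF assms])

lemma (in group) eval_word_letter: "f s \<in> carrier G \<Longrightarrow> eval_word G f (letter s) = f s"
  by (simp add: letter_def letter_val_def)

lemma (in group) mult_inv_cancel: "x \<in> carrier G \<Longrightarrow> y \<in> carrier G \<Longrightarrow> x \<otimes> (inv x \<otimes> y) = y"
  by (simp add: m_assoc[symmetric])

lemma (in group) inv_mult_cancel: "x \<in> carrier G \<Longrightarrow> y \<in> carrier G \<Longrightarrow> inv x \<otimes> (x \<otimes> y) = y"
  by (simp add: m_assoc[symmetric])

lemma hom_inv:
  assumes "h \<in> hom G H" "group G" "group H" "x \<in> carrier G"
  shows "h (inv\<^bsub>G\<^esub> x) = inv\<^bsub>H\<^esub> (h x)"
  using assms by (simp add: group_hom.hom_inv group_hom_axioms_def group_hom_def)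

lemma (in group) free_group_hom_eqI:
  assumes k: "k \<in> hom (free_group S) G" "k' \<in> hom (free_group S) G"
    and eq: "\<And>s. s \<in> S \<Longrightarrow> k (letter s) = k' (letter s)"
    and v: "v \<in> carrier (free_group S)"
  shows "k v = k' v"
proof -
  interpret F: group "free_group S" by (rule group_free_group)
  show ?thesis
    using v
    by (induction rule: free_group_induct)
      (auto simp: hom_mult[OF k(1)] hom_mult[OF k(2)] hom_inv[OF k(1) F.is_group is_group]
        hom_inv[OF k(2) F.is_group is_group] hom_one[OF k(1) F.is_group is_group]
        hom_one[OF k(2) F.is_group is_group] letter_closed eq)
qed

lemma restrict_hom:
  assumes "group G" "h \<in> hom G H"
  shows "restrict h (carrier G) \<in> hom G H"
proof -
  interpret group G by (fact assms)
  show ?thesis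
    using assms(2) by (auto simp: hom_def Pi_iff)
qed

theorem free_group_on_free_group: "free_group_on TYPE('t) (free_group S) S letter"
  unfolding free_group_on_def
proof (intro conjI allI impI)
  fix H :: "'t monoid" and f
  assume H: "group H" and f: "f \<in> S \<rightarrow> carrier H"
  interpret H: group H by (fact H)
  show "\<exists>!k. k \<in> hom (free_group S) H \<and> k \<in> extensional (carrier (free_group S)) \<and>
    (\<forall>s\<in>S. k (letter s) = f s)"
  proof (rule ex_ex1I)
    have "restrict (eval_word H f) (carrier (free_group S)) \<in> hom (free_group S) H"
      by (rule restrict_hom[OF group_free_group H.eval_word_hom[OF f]])
    moreover have "eval_word H f (letter s) = f s" if "s \<in> S" for s
      using f that by (auto intro: H.eval_word_letter)
    ultimately show "\<exists>k. k \<in> hom (free_group S) H \<and> k \<in> extensional (carrier (free_group S)) \<and>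
        (\<forall>s\<in>S. k (letter s) = f s)"
      by (intro exI[of _ "restrict (eval_word H f) (carrier (free_group S))"])
        (simp add: letter_closed)
  next
    fix k k'
    assume k: "k \<in> hom (free_group S) H \<and> k \<in> extensional (carrier (free_group S)) \<and>
        (\<forall>s\<in>S. k (letter s) = f s)"
      and k': "k' \<in> hom (free_group S) H \<and> k' \<in> extensional (carrier (free_group S)) \<and>
        (\<forall>s\<in>S. k' (letter s) = f s)"
    show "k = k'"
      by (rule extensionalityI[of _ "carrier (free_group S)"])
        (use k k' H.free_group_hom_eqI[of k S k'] in simp_all)
  qed
qed (auto simp: group_free_group letter_closed)

section \<open>Free crossed modules\<close>

lemma push_letter_map:
  assumes "inj_on g S" "snd x \<in> S" "snd ` set v \<subseteq> S"
  shows "push_letter (map_prod id g x) (map (map_prod id g) v) = map (map_prod id g) (push_letter x v)"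
proof (cases v)
  case (Cons y v')
  with assms have "cancelling (map_prod id g x) (map_prod id g y) \<longleftrightarrow> cancelling x y"
    by (auto simp: cancelling_def inj_on_eq_iff)
  with Cons show ?thesis by simp
qed simp

text \<open>Injectivity of \<open>g\<close> makes exactly the same pairs of letters cancel before
  and after relabelling. The case of interest is right translation of the symbols
  \<open>s^u\<close>, which makes the letterwise \<open>pre_act\<close> a homomorphism.\<close>

lemma map_free_group_hom:
  assumes "inj_on g S" "g \<in> S \<rightarrow> T"
  shows "map (map_prod id g) \<in> hom (free_group S) (free_group T)"
proof (rule homI)
  fix v assume v: "v \<in> carrier (free_group S)"
  have "reduced (map (map_prod id g) v)"
    unfolding successively_map
    by (rule successively_mono[where P = "\<lambda>x y. \<not> cancelling x y"])
      (use v assms(1) in \<open>auto simp: carrier_free_group cancelling_def inj_on_def image_subset_iff\<close>)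
  moreover have "snd ` set (map (map_prod id g) v) \<subseteq> T"
    using v assms(2) by (force simp: carrier_free_group)
  ultimately show "map (map_prod id g) v \<in> carrier (free_group T)"
    by (simp add: carrier_free_group)
next
  fix u v assume "u \<in> carrier (free_group S)" "v \<in> carrier (free_group S)"
  then have uv: "snd ` set u \<subseteq> S" "snd ` set v \<subseteq> S"
    by (auto simp: carrier_free_group)
  define h where "h = map_prod (id :: bool \<Rightarrow> bool) g"
  have "map h (foldr push_letter u v) = foldr push_letter (map h u) (map h v)"
    using uv(1)
  proof (induction u)
    case (Cons x u)
    have "snd ` set (foldr push_letter u v) \<subseteq> S"
      using Cons.prems uv(2) set_foldr_push_letter[of u v] by fastforce
    then have "push_letter (h x) (map h (foldr push_letter u v)) =
        map h (push_letter x (foldr push_letter u v))"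
      unfolding h_def using Cons.prems by (intro push_letter_map[OF assms(1)]) auto
    with Cons show ?case by simp
  qed simp
  then show "map (map_prod id g) (u \<otimes>\<^bsub>free_group S\<^esub> v) =
      map (map_prod id g) u \<otimes>\<^bsub>free_group T\<^esub> map (map_prod id g) v"
    by (simp only: mult_free_group h_def)
qed

section \<open>The free group on the formal symbols \<open>s^u\<close>, its action and its
  boundary\<close>

locale free_xmod_presentation = group F for F :: "('f, 'x) monoid_scheme" (structure) +
  fixes S :: "'s set" and w :: "'s \<Rightarrow> 'f"
  assumes relator_closed: "w \<in> S \<rightarrow> carrier F"
begin

abbreviation "P \<equiv> pre_group F S"
abbreviation "R \<equiv> peiffer_subgroup F S w"
abbreviation "M \<equiv> free_xmod F S w"

abbreviation cls :: "('s \<times> 'f) word \<Rightarrow> ('s \<times> 'f) word set" where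
  "cls p \<equiv> R #>\<^bsub>P\<^esub> p"

sublocale P: group P
  by (simp add: pre_group_def group_free_group)

lemma pre_letter_closed [simp]: "s \<in> S \<Longrightarrow> u \<in> carrier F \<Longrightarrow> letter (s, u) \<in> carrier P"
  by (simp add: pre_group_def letter_closed)

lemma pre_act_letter: "pre_act F (letter (s, u)) v = letter (s, u \<otimes> v)"
  by (simp add: pre_act_def letter_def)

lemma pre_act_hom:
  assumes "v \<in> carrier F"
  shows "(\<lambda>p. pre_act F p v) \<in> hom P P"
proof -
  let ?g = "\<lambda>(s, u). (s, u \<otimes> v) :: 's \<times> 'f"
  have "map (map_prod id ?g) \<in> hom P P"
    unfolding pre_group_def
    by (rule map_free_group_hom) (use assms in \<open>auto simp: inj_on_def\<close>)
  moreover have "map_prod id ?g = (\<lambda>(e, s, u). (e, s, u \<otimes> v))"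
    by (auto simp: fun_eq_iff)
  ultimately show ?thesis
    unfolding pre_act_def by metis
qed

lemma pre_act_closed [simp]: "p \<in> carrier P \<Longrightarrow> v \<in> carrier F \<Longrightarrow> pre_act F p v \<in> carrier P"
  using pre_act_hom by (auto simp: hom_def)

lemma pre_carrierD:
  "p \<in> carrier P \<Longrightarrow> (e, s, u) \<in> set p \<Longrightarrow> s \<in> S \<and> u \<in> carrier F"
  by (force simp: pre_group_def carrier_free_group)

lemma pre_act_one: "p \<in> carrier P \<Longrightarrow> pre_act F p \<one> = p"
  unfolding pre_act_def by (rule map_idI) (auto dest: pre_carrierD)

lemma pre_act_act:
  "p \<in> carrier P \<Longrightarrow> u \<in> carrier F \<Longrightarrow> v \<in> carrier F \<Longrightarrow>
    pre_act F (pre_act F p u) v = pre_act F p (u \<otimes> v)"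
  by (auto simp: pre_act_def m_assoc dest: pre_carrierD)

text \<open>Both sides are homomorphisms in \<open>p\<close>, so letters suffice. The map \<alpha>
  is a conjugation for the boundary, the action of the target for the universal property, and the
  identity, with two different labellings, for \<open>h_2\<close>.\<close>

lemma eval_word_pre_act:
  fixes H :: "('h, 'y) monoid_scheme"
  assumes H: "group H" and \<alpha>: "\<alpha> \<in> hom H H"
    and f: "f \<in> S \<times> carrier F \<rightarrow> carrier H" "f' \<in> S \<times> carrier F \<rightarrow> carrier H"
    and eq: "\<And>s u. s \<in> S \<Longrightarrow> u \<in> carrier F \<Longrightarrow> f (s, u \<otimes> v) = \<alpha> (f' (s, u))"
    and v: "v \<in> carrier F" and p: "p \<in> carrier P"
  shows "eval_word H f (pre_act F p v) = \<alpha> (eval_word H f' p)"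
proof -
  interpret H: group H by (fact H)
  have "(eval_word H f \<circ> (\<lambda>p. pre_act F p v)) p = (\<alpha> \<circ> eval_word H f') p"
  proof (rule H.free_group_hom_eqI[of _ "S \<times> carrier F"])
    show "eval_word H f \<circ> (\<lambda>p. pre_act F p v) \<in> hom (free_group (S \<times> carrier F)) H"
      using Group.hom_compose[OF pre_act_hom[OF v]] H.eval_word_hom[OF f(1)]
      by (auto simp: pre_group_def)
    show "\<alpha> \<circ> eval_word H f' \<in> hom (free_group (S \<times> carrier F)) H"
      by (rule Group.hom_compose[OF H.eval_word_hom[OF f(2)] \<alpha>])
    show "p \<in> carrier (free_group (S \<times> carrier F))"
      using p by (simp add: pre_group_def)
    show "(eval_word H f \<circ> (\<lambda>p. pre_act F p v)) (letter x) = (\<alpha> \<circ> eval_word H f') (letter x)"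
      if mem: "x \<in> S \<times> carrier F" for x
    proof -
      obtain s u where x: "x = (s, u)" "s \<in> S" "u \<in> carrier F"
        using mem by auto
      then have "f (s, u \<otimes> v) \<in> carrier H" "f' (s, u) \<in> carrier H"
        using f v by auto
      then show ?thesis
        by (simp add: x pre_act_letter H.eval_word_letter eq)
    qed
  qed
  then show ?thesis by simp
qed

lemma conj_relator_closed:
  "(\<lambda>(s, u). inv u \<otimes> w s \<otimes> u) \<in> S \<times> carrier F \<rightarrow> carrier F"
  using relator_closed by auto

lemma pre_bd_hom: "pre_bd F w \<in> hom P F"
  unfolding pre_bd_def pre_group_def by (rule eval_word_hom[OF conj_relator_closed])

lemma pre_bd_closed [simp]: "p \<in> carrier P \<Longrightarrow> pre_bd F w p \<in> carrier F"
  using pre_bd_hom by (auto simp: hom_def)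

lemma conj_hom: "v \<in> carrier F \<Longrightarrow> (\<lambda>x. inv v \<otimes> x \<otimes> v) \<in> hom F F"
  by (rule homI) (simp_all add: m_assoc mult_inv_cancel)

lemma pre_bd_act:
  assumes "p \<in> carrier P" "v \<in> carrier F"
  shows "pre_bd F w (pre_act F p v) = inv v \<otimes> pre_bd F w p \<otimes> v"
  unfolding pre_bd_def
proof (rule eval_word_pre_act[OF is_group conj_hom])
  fix s u assume "s \<in> S" "u \<in> carrier F"
  then show "(case (s, u \<otimes> v) of (s, u) \<Rightarrow> inv u \<otimes> w s \<otimes> u) =
      inv v \<otimes> (case (s, u) of (s, u) \<Rightarrow> inv u \<otimes> w s \<otimes> u) \<otimes> v"
    using assms relator_closed by (auto simp: m_assoc inv_mult_group Pi_iff)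
qed (use assms conj_relator_closed in auto)

section \<open>The Peiffer subgroup and the quotient by it\<close>

definition peiffer :: "('s \<times> 'f) word \<Rightarrow> ('s \<times> 'f) word \<Rightarrow> ('s \<times> 'f) word" where
  "peiffer p q = inv\<^bsub>P\<^esub> p \<otimes>\<^bsub>P\<^esub> q \<otimes>\<^bsub>P\<^esub> p \<otimes>\<^bsub>P\<^esub> inv\<^bsub>P\<^esub> (pre_act F q (pre_bd F w p))"

lemma peiffer_closed: "p \<in> carrier P \<Longrightarrow> q \<in> carrier P \<Longrightarrow> peiffer p q \<in> carrier P"
  by (simp add: peiffer_def)

lemma peiffer_subgroup_altdef:
  "R = \<Inter>{N. N \<lhd> P \<and> (\<forall>p\<in>carrier P. \<forall>q\<in>carrier P. peiffer p q \<in> N)}"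
  by (simp add: peiffer_subgroup_def peiffer_def Let_def)

lemma peiffer_subgroup_least:
  "N \<lhd> P \<Longrightarrow> (\<And>p q. p \<in> carrier P \<Longrightarrow> q \<in> carrier P \<Longrightarrow> peiffer p q \<in> N) \<Longrightarrow> R \<subseteq> N"
  unfolding peiffer_subgroup_altdef by blast

lemma peiffer_mem: "p \<in> carrier P \<Longrightarrow> q \<in> carrier P \<Longrightarrow> peiffer p q \<in> R"
  unfolding peiffer_subgroup_altdef by blast

lemma normal_carrier: "carrier P \<lhd> P"
  by (rule P.normal_invI[OF P.subgroup_self]) auto

lemma peiffer_subgroup_normal: "R \<lhd> P"
proof (rule P.normal_invI)
  let ?A = "{N. N \<lhd> P \<and> (\<forall>p\<in>carrier P. \<forall>q\<in>carrier P. peiffer p q \<in> N)}"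
  \<comment> \<open>The intersection is a subgroup only over a nonempty family.\<close>
  have ne: "carrier P \<in> ?A"
    using normal_carrier peiffer_closed by blast
  show "subgroup R P"
    unfolding peiffer_subgroup_altdef
    by (rule P.subgroups_Inter) (use ne in \<open>auto simp: normal_imp_subgroup\<close>)
  show "x \<otimes>\<^bsub>P\<^esub> h \<otimes>\<^bsub>P\<^esub> inv\<^bsub>P\<^esub> x \<in> R" if "x \<in> carrier P" "h \<in> R" for x h
    using that unfolding peiffer_subgroup_altdef by (auto intro: normal.inv_op_closed2)
qed

sublocale R: normal R P
  by (rule peiffer_subgroup_normal)

lemma group_free_xmod: "group M"
  unfolding free_xmod_def by (rule R.factorgroup_is_group)

sublocale M: group M
  by (rule group_free_xmod)

lemma cls_hom: "cls \<in> hom P M"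
  unfolding free_xmod_def by (rule R.r_coset_hom_Mod)

lemma carrier_free_xmod: "carrier M = cls ` carrier P"
  by (simp add: free_xmod_def carrier_FactGroup)

lemma cls_closed [simp]: "p \<in> carrier P \<Longrightarrow> cls p \<in> carrier M"
  by (simp add: carrier_free_xmod)

lemma cls_mult: "p \<in> carrier P \<Longrightarrow> q \<in> carrier P \<Longrightarrow> cls p \<otimes>\<^bsub>M\<^esub> cls q = cls (p \<otimes>\<^bsub>P\<^esub> q)"
  using hom_mult[OF cls_hom] by simp

lemma cls_inv: "p \<in> carrier P \<Longrightarrow> inv\<^bsub>M\<^esub> (cls p) = cls (inv\<^bsub>P\<^esub> p)"
  using hom_inv[OF cls_hom P.is_group M.is_group] by simp

lemma cls_eqI:
  assumes "p \<in> carrier P" "q \<in> carrier P" "p \<otimes>\<^bsub>P\<^esub> inv\<^bsub>P\<^esub> q \<in> R"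
  shows "cls p = cls q"
proof -
  have "p = (p \<otimes>\<^bsub>P\<^esub> inv\<^bsub>P\<^esub> q) \<otimes>\<^bsub>P\<^esub> q"
    using assms by (simp add: P.m_assoc)
  then have "p \<in> cls q"
    using assms(3) by (auto simp: r_coset_def)
  then show ?thesis
    using P.repr_independence[OF _ assms(2) R.subgroup_axioms] by metis
qed

text \<open>Homomorphisms out of the free crossed module are built from homomorphisms of \<open>P\<close> that
  turn the action of \<open>pre_bd p\<close> into conjugation by \<open>p\<close>.\<close>

definition descends :: "('h, 'y) monoid_scheme \<Rightarrow> (('s \<times> 'f) word \<Rightarrow> 'h) \<Rightarrow> bool" where
  "descends H k \<longleftrightarrow> k \<in> hom P H \<and>
     (\<forall>p\<in>carrier P. \<forall>q\<in>carrier P.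
        k (pre_act F q (pre_bd F w p)) = inv\<^bsub>H\<^esub> (k p) \<otimes>\<^bsub>H\<^esub> k q \<otimes>\<^bsub>H\<^esub> k p)"

lemma peiffer_subgroup_kernel:
  assumes "group H" "descends H k"
  shows "R \<subseteq> kernel P H k"
proof -
  interpret H: group H by (fact assms)
  interpret k: group_hom P H k
    by unfold_locales (use assms in \<open>simp add: descends_def\<close>)
  have "k (peiffer p q) = \<one>\<^bsub>H\<^esub>" if "p \<in> carrier P" "q \<in> carrier P" for p q
    using that assms(2) by (simp add: peiffer_def descends_def)
  then show ?thesis
    by (intro peiffer_subgroup_least k.normal_kernel) (auto simp: kernel_def peiffer_closed)
qed

lemma descends_cls:
  assumes "group H" "descends H k" "p \<in> carrier P"
  shows "the_elem (k ` cls p) = k p"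
proof -
  interpret H: group H by (fact assms)
  interpret k: group_hom P H k
    by unfold_locales (use assms in \<open>simp add: descends_def\<close>)
  have "k (r \<otimes>\<^bsub>P\<^esub> p) = k p" if "r \<in> R" for r
    using peiffer_subgroup_kernel[OF assms(1,2)] that assms(3) by (auto simp: kernel_def)
  then have "k ` cls p = {k p}"
    using P.rcos_self[OF assms(3) R.subgroup_axioms] by (auto simp: r_coset_def)
  then show ?thesis by simp
qed

lemma descends_hom:
  assumes "group H" "descends H k"
  shows "(\<lambda>K. the_elem (k ` K)) \<in> hom M H"
proof (rule homI)
  have k: "k \<in> hom P H"
    using assms by (simp add: descends_def)
  show "the_elem (k ` K) \<in> carrier H" if "K \<in> carrier M" for K
    using that k assms by (auto simp: carrier_free_xmod descends_cls hom_def)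
  show "the_elem (k ` (K \<otimes>\<^bsub>M\<^esub> L)) = the_elem (k ` K) \<otimes>\<^bsub>H\<^esub> the_elem (k ` L)"
    if "K \<in> carrier M" "L \<in> carrier M" for K L
    using that by (auto simp: carrier_free_xmod cls_mult descends_cls[OF assms] hom_mult[OF k])
qed

lemma pre_bd_descends: "descends F (pre_bd F w)"
  by (simp add: descends_def pre_bd_hom pre_bd_act)

lemma free_xmod_bd_cls: "p \<in> carrier P \<Longrightarrow> free_xmod_bd F w (cls p) = pre_bd F w p"
  by (simp add: free_xmod_bd_def descends_cls[OF is_group pre_bd_descends])

lemma free_xmod_bd_hom: "free_xmod_bd F w \<in> hom M F"
  using descends_hom[OF is_group pre_bd_descends] by (simp add: free_xmod_bd_def[abs_def])

text \<open>Translating \<open>p\<close> by \<open>v\<close> conjugates its boundary by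
  \<open>v\<close>, so translating \<open>q\<close> first by \<open>v\<close> and then by the new
  boundary equals translating it first by the old boundary and then by \<open>v\<close>.\<close>

lemma peiffer_act:
  assumes "p \<in> carrier P" "q \<in> carrier P" "v \<in> carrier F"
  shows "pre_act F (peiffer p q) v = peiffer (pre_act F p v) (pre_act F q v)"
proof -
  have "pre_act F (pre_act F q v) (pre_bd F w (pre_act F p v)) =
      pre_act F (pre_act F q (pre_bd F w p)) v"
    using assms by (simp add: pre_act_act pre_bd_act m_assoc mult_inv_cancel)
  then show ?thesis
    using assms
    by (simp add: peiffer_def hom_mult[OF pre_act_hom] hom_inv[OF pre_act_hom P.is_group P.is_group])
qed

text \<open>\<open>R\<close> is given as an intersection, so its elements cannot be handled one by
  one. Minimality is used instead: the kernel of the map taking \<open>p\<close> to the class of its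
  translate is normal and contains all Peiffer elements.\<close>

lemma peiffer_subgroup_act:
  assumes "r \<in> R" "v \<in> carrier F"
  shows "pre_act F r v \<in> R"
proof -
  let ?\<alpha> = "\<lambda>p. cls (pre_act F p v)"
  interpret \<alpha>: group_hom P M ?\<alpha>
    using Group.hom_compose[OF pre_act_hom[OF assms(2)] cls_hom]
    by unfold_locales (simp add: comp_def)
  have "?\<alpha> (peiffer p q) = \<one>\<^bsub>M\<^esub>" if "p \<in> carrier P" "q \<in> carrier P" for p q
    using that assms(2) R.rcos_const peiffer_mem
    by (simp add: peiffer_act free_xmod_def)
  then have "R \<subseteq> kernel P M ?\<alpha>"
    by (intro peiffer_subgroup_least \<alpha>.normal_kernel) (auto simp: kernel_def peiffer_closed)
  then have "cls (pre_act F r v) = R" "r \<in> carrier P"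
    using assms(1) by (auto simp: kernel_def free_xmod_def)
  then show ?thesis
    using P.coset_join1[OF _ _ R.subgroup_axioms] assms(2) R.subset by simp
qed

lemma free_xmod_act_cls:
  assumes "p \<in> carrier P" "v \<in> carrier F"
  shows "free_xmod_act F (cls p) v = cls (pre_act F p v)"
proof
  have "pre_act F (r \<otimes>\<^bsub>P\<^esub> p) v = pre_act F r v \<otimes>\<^bsub>P\<^esub> pre_act F p v" if "r \<in> R" for r
    using that assms R.subset by (intro hom_mult[OF pre_act_hom]) auto
  then show "free_xmod_act F (cls p) v \<subseteq> cls (pre_act F p v)"
    using peiffer_subgroup_act assms(2) by (force simp: free_xmod_act_def r_coset_def)
  show "cls (pre_act F p v) \<subseteq> free_xmod_act F (cls p) v"
  proof
    fix x assume "x \<in> cls (pre_act F p v)"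
    then obtain r where r: "r \<in> R" "x = r \<otimes>\<^bsub>P\<^esub> pre_act F p v"
      by (auto simp: r_coset_def)
    then have rP: "r \<in> carrier P"
      using R.subset by auto
    \<comment> \<open>The factor \<open>r\<close> is translated back by \<open>inv v\<close>, which
      keeps it in \<open>R\<close>; hence the translate of a coset fills a whole coset.\<close>
    have "x = pre_act F (pre_act F r (inv v) \<otimes>\<^bsub>P\<^esub> p) v"
      using rP r(2) assms by (simp add: hom_mult[OF pre_act_hom] pre_act_act pre_act_one)
    moreover have "pre_act F r (inv v) \<otimes>\<^bsub>P\<^esub> p \<in> cls p"
      using peiffer_subgroup_act[OF r(1)] assms(2) by (auto simp: r_coset_def)
    ultimately show "x \<in> free_xmod_act F (cls p) v"
      by (auto simp: free_xmod_act_def)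
  qed
qed

section \<open>Crossed module axioms and universal property of the quotient\<close>

lemma crossed_module_free_xmod: "crossed_module F M (free_xmod_act F) (free_xmod_bd F w)"
  unfolding crossed_module_def right_action_def
proof (intro conjI ballI)
  fix v assume v: "v \<in> carrier F"
  show "(\<lambda>m. free_xmod_act F m v) \<in> hom M M"
    by (rule homI)
      (use v in \<open>auto simp: carrier_free_xmod free_xmod_act_cls cls_mult hom_mult[OF pre_act_hom]\<close>)
next
  fix m n assume "m \<in> carrier M" "n \<in> carrier M"
  then obtain p q where pq: "m = cls p" "n = cls q" "p \<in> carrier P" "q \<in> carrier P"
    by (auto simp: carrier_free_xmod)
  \<comment> \<open>The quotient of the two words is \<open>peiffer q p\<close>: the relations
    imposed are exactly the second crossed module axiom.\<close>
  then have "cls (inv\<^bsub>P\<^esub> q \<otimes>\<^bsub>P\<^esub> p \<otimes>\<^bsub>P\<^esub> q) = cls (pre_act F p (pre_bd F w q))"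
    using peiffer_mem by (intro cls_eqI) (auto simp: peiffer_def)
  with pq show "inv\<^bsub>M\<^esub> n \<otimes>\<^bsub>M\<^esub> m \<otimes>\<^bsub>M\<^esub> n = free_xmod_act F m (free_xmod_bd F w n)"
    by (simp add: cls_inv cls_mult free_xmod_bd_cls free_xmod_act_cls)
qed (auto simp: carrier_free_xmod free_xmod_act_cls pre_act_one pre_act_act free_xmod_bd_cls
      pre_bd_act free_xmod_bd_hom is_group M.is_group)

text \<open>The maps are plain group homomorphisms, without equivariance, so agreement is asked on
  all translates of the generators: these generate \<open>M\<close> as a group, being the classes of
  the letters of \<open>P\<close>.\<close>

lemma free_xmod_hom_eqI:
  assumes H: "group H" and k: "k \<in> hom M H" "k' \<in> hom M H"
    and eq: "\<And>s u. s \<in> S \<Longrightarrow> u \<in> carrier F \<Longrightarrow>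
      k (free_xmod_act F (free_xmod_gen F S w s) u) = k' (free_xmod_act F (free_xmod_gen F S w s) u)"
    and m: "m \<in> carrier M"
  shows "k m = k' m"
proof -
  interpret H: group H by (fact H)
  obtain p where p: "m = cls p" "p \<in> carrier P"
    using m by (auto simp: carrier_free_xmod)
  have "(k \<circ> cls) p = (k' \<circ> cls) p"
  proof (rule H.free_group_hom_eqI[of _ "S \<times> carrier F"])
    show "k \<circ> cls \<in> hom (free_group (S \<times> carrier F)) H" "k' \<circ> cls \<in> hom (free_group (S \<times> carrier F)) H"
      using Group.hom_compose[OF cls_hom] k by (auto simp: pre_group_def)
    show "(k \<circ> cls) (letter x) = (k' \<circ> cls) (letter x)" if mem: "x \<in> S \<times> carrier F" for x
    proof -
      obtain s u where "x = (s, u)" "s \<in> S" "u \<in> carrier F"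
        using mem by auto
      with eq[of s u] show ?thesis
        by (simp add: free_xmod_gen_def free_xmod_act_cls pre_act_letter)
    qed
  qed (use p in \<open>simp add: pre_group_def\<close>)
  with p show ?thesis by simp
qed

lemma free_xmod_gen_closed [simp]: "s \<in> S \<Longrightarrow> free_xmod_gen F S w s \<in> carrier M"
  by (simp add: free_xmod_gen_def)

lemma free_xmod_bd_gen: "s \<in> S \<Longrightarrow> free_xmod_bd F w (free_xmod_gen F S w s) = w s"
  using relator_closed
  by (auto simp: free_xmod_gen_def free_xmod_bd_cls pre_bd_def eval_word_letter Pi_iff)

theorem free_crossed_module_on_free_xmod:
  "free_crossed_module_on TYPE('t) F S w M (free_xmod_act F) (free_xmod_bd F w) (free_xmod_gen F S w)"
  unfolding free_crossed_module_on_def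
proof (intro conjI allI impI)
  fix N :: "'t monoid" and act \<nu> f
  assume N: "crossed_module F N act \<nu>" and f: "f \<in> S \<rightarrow> carrier N"
    and \<nu>f: "\<forall>s\<in>S. \<nu> (f s) = w s"
  interpret N: group N
    using N by (simp add: crossed_module_def)
  have act_hom: "(\<lambda>m. act m u) \<in> hom N N" if "u \<in> carrier F" for u
    using N that by (simp add: crossed_module_def right_action_def)
  have act_one: "act m \<one> = m" if "m \<in> carrier N" for m
    using N that by (simp add: crossed_module_def right_action_def)
  have act_act: "act (act m u) v = act m (u \<otimes> v)"
    if "m \<in> carrier N" "u \<in> carrier F" "v \<in> carrier F" for m u v
    using N that by (simp add: crossed_module_def right_action_def)
  have \<nu>: "\<nu> \<in> hom N F"
    using N by (simp add: crossed_module_def)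
  have \<nu>_act: "\<nu> (act m u) = inv u \<otimes> \<nu> m \<otimes> u" if "m \<in> carrier N" "u \<in> carrier F" for m u
    using N that by (simp add: crossed_module_def)
  have conj: "inv\<^bsub>N\<^esub> n \<otimes>\<^bsub>N\<^esub> m \<otimes>\<^bsub>N\<^esub> n = act m (\<nu> n)" if "m \<in> carrier N" "n \<in> carrier N" for m n
    using N that by (simp add: crossed_module_def)
  \<comment> \<open>Equivariance leaves no choice: the letter \<open>(s, u)\<close> stands for
    \<open>s^u\<close> and must go to \<open>f s\<close> acted on by \<open>u\<close>.\<close>
  define f' where "f' = (\<lambda>(s, u). act (f s) u)"
  have f': "f' \<in> S \<times> carrier F \<rightarrow> carrier N"
    using f act_hom by (fastforce simp: f'_def hom_def)
  define k where "k = eval_word N f'"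
  have k: "k \<in> hom P N"
    unfolding k_def pre_group_def by (rule N.eval_word_hom[OF f'])
  then have kc: "k p \<in> carrier N" if "p \<in> carrier P" for p
    using that by (auto simp: hom_def)
  have k_letter: "k (letter (s, u)) = act (f s) u" if "s \<in> S" "u \<in> carrier F" for s u
  proof -
    have "f' (s, u) \<in> carrier N"
      using f' that by auto
    then show ?thesis
      by (simp add: k_def N.eval_word_letter) (simp add: f'_def)
  qed
  have k_act: "k (pre_act F p v) = act (k p) v" if "p \<in> carrier P" "v \<in> carrier F" for p v
    unfolding k_def
    by (rule eval_word_pre_act[OF N.is_group act_hom f' f'])
      (use that f in \<open>auto simp: f'_def act_act Pi_iff\<close>)
  have \<nu>k: "\<nu> (k p) = pre_bd F w p" if "p \<in> carrier P" for p
  proof -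
    have "(\<nu> \<circ> k) p = pre_bd F w p"
    proof (rule free_group_hom_eqI[of _ "S \<times> carrier F"])
      show "\<nu> \<circ> k \<in> hom (free_group (S \<times> carrier F)) F"
        using Group.hom_compose[OF k \<nu>] by (simp add: pre_group_def)
      show "pre_bd F w \<in> hom (free_group (S \<times> carrier F)) F"
        using pre_bd_hom by (simp add: pre_group_def)
      show "(\<nu> \<circ> k) (letter x) = pre_bd F w (letter x)" if mem: "x \<in> S \<times> carrier F" for x
      proof -
        obtain s u where x: "x = (s, u)" "s \<in> S" "u \<in> carrier F"
          using mem by auto
        then have "w s \<in> carrier F" "f s \<in> carrier N"
          using relator_closed f by auto
        with x \<nu>f show ?thesis
          by (simp add: k_letter \<nu>_act pre_bd_def eval_word_letter)
      qed
    qed (use that in \<open>simp add: pre_group_def\<close>)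
    then show ?thesis by simp
  qed
  \<comment> \<open>The Peiffer identity of \<open>N\<close>, read through \<open>\<nu>k\<close>, is
    exactly the condition for passing to the quotient.\<close>
  have desc: "descends N k"
    by (simp add: descends_def k k_act kc conj \<nu>k)
  define kM where "kM = restrict (\<lambda>K. the_elem (k ` K)) (carrier M)"
  have k_cls: "kM (cls p) = k p" if "p \<in> carrier P" for p
    using that by (simp add: kM_def descends_cls[OF N.is_group desc])
  show "\<exists>!k. k \<in> hom M N \<and> k \<in> extensional (carrier M) \<and>
      (\<forall>m\<in>carrier M. \<nu> (k m) = free_xmod_bd F w m) \<and>
      (\<forall>m\<in>carrier M. \<forall>u\<in>carrier F. k (free_xmod_act F m u) = act (k m) u) \<and>
      (\<forall>s\<in>S. k (free_xmod_gen F S w s) = f s)"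
  proof (rule ex_ex1I)
    have "kM \<in> hom M N"
      unfolding kM_def by (rule restrict_hom[OF M.is_group descends_hom[OF N.is_group desc]])
    moreover have "\<nu> (kM m) = free_xmod_bd F w m" if "m \<in> carrier M" for m
      using that by (auto simp: carrier_free_xmod k_cls \<nu>k free_xmod_bd_cls)
    moreover have "kM (free_xmod_act F m u) = act (kM m) u"
      if "m \<in> carrier M" "u \<in> carrier F" for m u
      using that
      by (auto simp: carrier_free_xmod k_cls k_act free_xmod_act_cls)
    moreover have "kM (free_xmod_gen F S w s) = f s" if "s \<in> S" for s
      using that f
      by (auto simp: free_xmod_gen_def k_cls k_letter act_one Pi_iff)
    moreover have "kM \<in> extensional (carrier M)"
      by (simp add: kM_def)
    ultimately show "\<exists>k. k \<in> hom M N \<and> k \<in> extensional (carrier M) \<and>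
        (\<forall>m\<in>carrier M. \<nu> (k m) = free_xmod_bd F w m) \<and>
        (\<forall>m\<in>carrier M. \<forall>u\<in>carrier F. k (free_xmod_act F m u) = act (k m) u) \<and>
        (\<forall>s\<in>S. k (free_xmod_gen F S w s) = f s)"
      by (intro exI[of _ kM]) simp
  next
    fix k1 k2
    assume k1: "k1 \<in> hom M N \<and> k1 \<in> extensional (carrier M) \<and>
        (\<forall>m\<in>carrier M. \<nu> (k1 m) = free_xmod_bd F w m) \<and>
        (\<forall>m\<in>carrier M. \<forall>u\<in>carrier F. k1 (free_xmod_act F m u) = act (k1 m) u) \<and>
        (\<forall>s\<in>S. k1 (free_xmod_gen F S w s) = f s)"
      and k2: "k2 \<in> hom M N \<and> k2 \<in> extensional (carrier M) \<and>
        (\<forall>m\<in>carrier M. \<nu> (k2 m) = free_xmod_bd F w m) \<and>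
        (\<forall>m\<in>carrier M. \<forall>u\<in>carrier F. k2 (free_xmod_act F m u) = act (k2 m) u) \<and>
        (\<forall>s\<in>S. k2 (free_xmod_gen F S w s) = f s)"
    have "k1 m = k2 m" if "m \<in> carrier M" for m
      by (rule free_xmod_hom_eqI[OF N.is_group _ _ _ that]) (use k1 k2 in auto)
    then show "k1 = k2"
      using k1 k2 by (intro extensionalityI[of _ "carrier M"]) auto
  qed
qed (auto simp: crossed_module_free_xmod free_xmod_bd_gen)

end

section \<open>Free modules\<close>

lemma free_mod_act_of [simp]: "free_mod_act G (frag_of (s, g)) h = frag_of (s, g \<otimes>\<^bsub>G\<^esub> h)"
  by (simp add: free_mod_act_def)

lemma free_mod_act_0 [simp]: "free_mod_act G 0 h = 0"
  by (simp add: free_mod_act_def)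

lemma free_mod_act_add: "free_mod_act G (c + d) h = free_mod_act G c h + free_mod_act G d h"
  by (simp add: free_mod_act_def frag_extend_add)

lemma free_mod_act_diff: "free_mod_act G (c - d) h = free_mod_act G c h - free_mod_act G d h"
  by (simp add: free_mod_act_def frag_extend_diff)

lemma carrier_free_mod: "c \<in> carrier (free_mod G S) \<longleftrightarrow> Poly_Mapping.keys c \<subseteq> S \<times> carrier G"
  by (simp add: free_mod_def)

lemma mult_free_mod [simp]: "c \<otimes>\<^bsub>free_mod G S\<^esub> d = c + d"
  by (simp add: free_mod_def)

lemma one_free_mod [simp]: "\<one>\<^bsub>free_mod G S\<^esub> = 0"
  by (simp add: free_mod_def)

lemma inv_free_mod [simp]: "c \<in> carrier (free_mod G S) \<Longrightarrow> inv\<^bsub>free_mod G S\<^esub> c = - c"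
  by (simp add: free_mod_def)

lemma comm_group_free_mod: "comm_group (free_mod G S)"
  by (simp add: free_mod_def abelian_free_Abelian_group)

lemma group_free_mod: "group (free_mod G S)"
  by (simp add: free_mod_def)

lemma free_mod_induct [consumes 1, case_names zero gen diff]:
  assumes "c \<in> carrier (free_mod G S)"
    and "P 0"
    and "\<And>s g. s \<in> S \<Longrightarrow> g \<in> carrier G \<Longrightarrow> P (frag_of (s, g))"
    and "\<And>c d. c \<in> carrier (free_mod G S) \<Longrightarrow> d \<in> carrier (free_mod G S) \<Longrightarrow>
           P c \<Longrightarrow> P d \<Longrightarrow> P (c - d)"
  shows "P c"
  by (rule free_Abelian_group_induct[of c "S \<times> carrier G"])
    (use assms in \<open>auto simp: carrier_free_mod\<close>)

lemma free_mod_diff_closed: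
  "c \<in> carrier (free_mod G S) \<Longrightarrow> d \<in> carrier (free_mod G S) \<Longrightarrow> c - d \<in> carrier (free_mod G S)"
  using keys_diff[of c d] by (auto simp: carrier_free_mod)

lemma hom_free_mod_diff:
  assumes "k \<in> hom (free_mod G S) H" "group H"
    and "c \<in> carrier (free_mod G S)" "d \<in> carrier (free_mod G S)"
  shows "k (c - d) = k c \<otimes>\<^bsub>H\<^esub> inv\<^bsub>H\<^esub> (k d)"
proof -
  have "c - d = c \<otimes>\<^bsub>free_mod G S\<^esub> inv\<^bsub>free_mod G S\<^esub> d"
    using assms by simp
  then show ?thesis
    using assms group.inv_closed[OF group_free_mod assms(4)]
    by (metis hom_mult hom_inv group_free_mod)
qed

lemma free_mod_hom_eqI:
  assumes "k \<in> hom (free_mod G S) H" "k' \<in> hom (free_mod G S) H" "group H"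
    and "\<And>s g. s \<in> S \<Longrightarrow> g \<in> carrier G \<Longrightarrow> k (frag_of (s, g)) = k' (frag_of (s, g))"
    and "c \<in> carrier (free_mod G S)"
  shows "k c = k' c"
  using assms(5)
proof (induction rule: free_mod_induct)
  case zero
  show ?case
    using hom_one[OF assms(1) group_free_mod assms(3)] hom_one[OF assms(2) group_free_mod assms(3)]
    by simp
qed (use assms in \<open>simp_all add: hom_free_mod_diff\<close>)

lemma (in group) free_mod_act_closed:
  assumes "c \<in> carrier (free_mod G S)" "h \<in> carrier G"
  shows "free_mod_act G c h \<in> carrier (free_mod G S)"
  using assms(1)
  by (induction rule: free_mod_induct)
    (use assms(2) in \<open>auto simp: free_mod_act_diff free_mod_diff_closed\<close>,
     auto simp: carrier_free_mod)

lemma (in group) free_mod_act_one: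
  "c \<in> carrier (free_mod G S) \<Longrightarrow> free_mod_act G c \<one> = c"
  by (induction rule: free_mod_induct) (auto simp: free_mod_act_diff)

lemma (in group) free_mod_act_act:
  assumes "c \<in> carrier (free_mod G S)" "g \<in> carrier G" "h \<in> carrier G"
  shows "free_mod_act G (free_mod_act G c g) h = free_mod_act G c (g \<otimes> h)"
  using assms(1)
  by (induction rule: free_mod_induct) (use assms in \<open>auto simp: free_mod_act_diff m_assoc\<close>)

lemma (in group) right_module_free_mod: "right_module G (free_mod G S) (free_mod_act G)"
  unfolding right_module_def right_action_def
  by (auto intro!: homI comm_group_free_mod
      simp: is_group free_mod_act_closed free_mod_act_add free_mod_act_one free_mod_act_act)

lemma (in group) free_mod_gen_closed: "s \<in> S \<Longrightarrow> free_mod_gen G s \<in> carrier (free_mod G S)"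
  by (simp add: free_mod_gen_def carrier_free_mod)

theorem (in group) free_module_on_free_mod:
  "free_module_on TYPE('t) G (free_mod G S) (free_mod_act G) S (free_mod_gen G)"
  unfolding free_module_on_def
proof (intro conjI allI impI)
  fix N :: "'t monoid" and act f
  assume N: "right_module G N act" and f: "f \<in> S \<rightarrow> carrier N"
  interpret N: comm_group N
    using N by (simp add: right_module_def)
  have act_hom: "(\<lambda>m. act m g) \<in> hom N N" if "g \<in> carrier G" for g
    using N that by (simp add: right_module_def right_action_def)
  have act_one: "act m \<one> = m" if "m \<in> carrier N" for m
    using N that by (simp add: right_module_def right_action_def)
  have act_act: "act (act m g) h = act m (g \<otimes> h)"
    if "m \<in> carrier N" "g \<in> carrier G" "h \<in> carrier G" for m g h
    using N that by (simp add: right_module_def right_action_def)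
  have fc: "f s \<in> carrier N" if "s \<in> S" for s
    using f that by auto
  have "(\<lambda>(s, g). act (f s) g) ` (S \<times> carrier G) \<subseteq> carrier N"
    using fc act_hom by (auto simp: hom_def Pi_iff)
  then obtain k where k: "k \<in> hom (free_mod G S) N"
    and k_of': "\<And>x. x \<in> S \<times> carrier G \<Longrightarrow> k (frag_of x) = (\<lambda>(s, g). act (f s) g) x"
    unfolding free_mod_def using N.free_Abelian_group_universal by blast
  have k_of: "k (frag_of (s, g)) = act (f s) g" if "s \<in> S" "g \<in> carrier G" for s g
    using k_of'[of "(s, g)"] that by simp
  have k_act: "k (free_mod_act G c g) = act (k c) g"
    if "c \<in> carrier (free_mod G S)" "g \<in> carrier G" for c g
  proof -
    have "(\<lambda>c. free_mod_act G c g) \<in> hom (free_mod G S) (free_mod G S)"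
      using right_module_free_mod[of S] that(2) by (simp add: right_module_def right_action_def)
    from Group.hom_compose[OF this k] Group.hom_compose[OF k act_hom[OF that(2)]]
    have "(k \<circ> (\<lambda>c. free_mod_act G c g)) c = ((\<lambda>m. act m g) \<circ> k) c"
      by (rule free_mod_hom_eqI[OF _ _ N.is_group _ that(1)])
        (use that(2) in \<open>simp add: k_of act_act fc\<close>)
    then show ?thesis by simp
  qed
  show "\<exists>!k. k \<in> hom (free_mod G S) N \<and> k \<in> extensional (carrier (free_mod G S)) \<and>
      (\<forall>m\<in>carrier (free_mod G S). \<forall>g\<in>carrier G. k (free_mod_act G m g) = act (k m) g) \<and>
      (\<forall>s\<in>S. k (free_mod_gen G s) = f s)"
  proof (rule ex_ex1I)
    show "\<exists>k. k \<in> hom (free_mod G S) N \<and> k \<in> extensional (carrier (free_mod G S)) \<and>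
        (\<forall>m\<in>carrier (free_mod G S). \<forall>g\<in>carrier G. k (free_mod_act G m g) = act (k m) g) \<and>
        (\<forall>s\<in>S. k (free_mod_gen G s) = f s)"
      by (rule exI[of _ "restrict k (carrier (free_mod G S))"])
        (use restrict_hom[OF group_free_mod k] in
          \<open>simp add: k_act free_mod_act_closed free_mod_gen_closed\<close>,
         simp add: free_mod_gen_def k_of act_one fc)
  next
    fix k1 k2
    assume k1: "k1 \<in> hom (free_mod G S) N \<and> k1 \<in> extensional (carrier (free_mod G S)) \<and>
        (\<forall>m\<in>carrier (free_mod G S). \<forall>g\<in>carrier G. k1 (free_mod_act G m g) = act (k1 m) g) \<and>
        (\<forall>s\<in>S. k1 (free_mod_gen G s) = f s)"
      and k2: "k2 \<in> hom (free_mod G S) N \<and> k2 \<in> extensional (carrier (free_mod G S)) \<and>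
        (\<forall>m\<in>carrier (free_mod G S). \<forall>g\<in>carrier G. k2 (free_mod_act G m g) = act (k2 m) g) \<and>
        (\<forall>s\<in>S. k2 (free_mod_gen G s) = f s)"
    have gen: "frag_of (s, g) = free_mod_act G (free_mod_gen G s) g" if "g \<in> carrier G" for s g
      using that by (simp add: free_mod_gen_def)
    have "k1 c = k2 c" if "c \<in> carrier (free_mod G S)" for c
      by (rule free_mod_hom_eqI[OF _ _ N.is_group _ that])
        (use k1 k2 in \<open>auto simp: gen free_mod_gen_closed\<close>)
    then show "k1 = k2"
      using k1 k2 by (intro extensionalityI[of _ "carrier (free_mod G S)"]) auto
  qed
qed (auto simp: right_module_free_mod free_mod_gen_closed)

section \<open>The standard crossed resolution\<close>

text \<open>\<open>cov_val G g v\<close>, \<open>h2c g m\<close> and \<open>std_shift G g c\<close> are the second components of \<open>h\<^sub>1 (g, v)\<close>, of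
  \<open>h\<^sub>2 (g, m)\<close> and of \<open>h\<^sub>n (g, c)\<close> for \<open>n \<ge> 3\<close>.\<close>

primrec cov_val :: "('g, 'x) monoid_scheme \<Rightarrow> 'g \<Rightarrow> 'g word \<Rightarrow> 'g std2" where
  "cov_val G g [] = \<one>\<^bsub>free_xmod (std_C1 G) (carrier G \<times> carrier G) (std_relator G)\<^esub>"
| "cov_val G g (x # v) =
     (if fst x then br2 G (g, snd x)
      else inv\<^bsub>free_xmod (std_C1 G) (carrier G \<times> carrier G) (std_relator G)\<^esub>
             (br2 G (g \<otimes>\<^bsub>G\<^esub> inv\<^bsub>G\<^esub> (snd x), snd x)))
     \<otimes>\<^bsub>free_xmod (std_C1 G) (carrier G \<times> carrier G) (std_relator G)\<^esub>
     cov_val G (g \<otimes>\<^bsub>G\<^esub> letter_val G (\<lambda>a. a) x) v"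

section \<open>The groups in dimensions 1 and 2 and the maps between them\<close>

locale standard_resolution = group G for G :: "'g monoid" (structure)
begin

abbreviation F :: "'g word monoid" where
  "F \<equiv> std_C1 G"

abbreviation M :: "'g std2 monoid" where
  "M \<equiv> free_xmod (std_C1 G) (carrier G \<times> carrier G) (std_relator G)"

abbreviation act :: "'g std2 \<Rightarrow> 'g word \<Rightarrow> 'g std2" where
  "act \<equiv> free_xmod_act (std_C1 G)"

abbreviation bd :: "'g std2 \<Rightarrow> 'g word" where
  "bd \<equiv> free_xmod_bd (std_C1 G) (std_relator G)"

abbreviation \<phi> :: "'g word \<Rightarrow> 'g" where
  "\<phi> \<equiv> eval_word G (\<lambda>a. a)"

sublocale F: group F
  by (simp add: std_C1_def group_free_group)

lemma letter_F [simp]: "a \<in> carrier G \<Longrightarrow> letter a \<in> carrier F"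
  by (simp add: std_C1_def letter_closed)

lemma relator_in_F: "std_relator G \<in> carrier G \<times> carrier G \<rightarrow> carrier F"
  by (auto simp: std_relator_def)

sublocale X: free_xmod_presentation F "carrier G \<times> carrier G" "std_relator G"
  by unfold_locales (rule relator_in_F)

lemma \<phi>_hom: "\<phi> \<in> hom F G"
  unfolding std_C1_def by (rule eval_word_hom) auto

sublocale \<phi>: group_hom F G \<phi>
  by unfold_locales (rule \<phi>_hom)

lemma \<phi>_letter [simp]: "a \<in> carrier G \<Longrightarrow> \<phi> (letter a) = a"
  by (simp add: eval_word_letter)

lemma bd_hom: "bd \<in> hom M F"
  by (rule X.free_xmod_bd_hom)

sublocale bd: group_hom M F bd
  by unfold_locales (rule bd_hom)

lemma act_hom: "u \<in> carrier F \<Longrightarrow> (\<lambda>m. act m u) \<in> hom M M"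
  using X.crossed_module_free_xmod by (simp add: crossed_module_def right_action_def)

lemma act_closed [simp]: "m \<in> carrier M \<Longrightarrow> u \<in> carrier F \<Longrightarrow> act m u \<in> carrier M"
  using act_hom by (auto simp: hom_def)

lemma act_mult:
  "m \<in> carrier M \<Longrightarrow> n \<in> carrier M \<Longrightarrow> u \<in> carrier F \<Longrightarrow> act (m \<otimes>\<^bsub>M\<^esub> n) u = act m u \<otimes>\<^bsub>M\<^esub> act n u"
  using hom_mult[OF act_hom] by auto

lemma act_one: "m \<in> carrier M \<Longrightarrow> act m \<one>\<^bsub>F\<^esub> = m"
  using X.crossed_module_free_xmod by (simp add: crossed_module_def right_action_def)

lemma act_act:
  "m \<in> carrier M \<Longrightarrow> u \<in> carrier F \<Longrightarrow> v \<in> carrier F \<Longrightarrow> act (act m u) v = act m (u \<otimes>\<^bsub>F\<^esub> v)"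
  using X.crossed_module_free_xmod by (simp add: crossed_module_def right_action_def)

lemma bd_act:
  "m \<in> carrier M \<Longrightarrow> u \<in> carrier F \<Longrightarrow> bd (act m u) = inv\<^bsub>F\<^esub> u \<otimes>\<^bsub>F\<^esub> bd m \<otimes>\<^bsub>F\<^esub> u"
  using X.crossed_module_free_xmod by (simp add: crossed_module_def)

lemma act_bd:
  "m \<in> carrier M \<Longrightarrow> n \<in> carrier M \<Longrightarrow> act m (bd n) = inv\<^bsub>M\<^esub> n \<otimes>\<^bsub>M\<^esub> m \<otimes>\<^bsub>M\<^esub> n"
  using X.crossed_module_free_xmod by (simp add: crossed_module_def)

lemma br2_closed [simp]: "a \<in> carrier G \<Longrightarrow> b \<in> carrier G \<Longrightarrow> br2 G (a, b) \<in> carrier M"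
  by (simp add: br2_def)

lemma bd_br2:
  "a \<in> carrier G \<Longrightarrow> b \<in> carrier G \<Longrightarrow>
    bd (br2 G (a, b)) = letter a \<otimes>\<^bsub>F\<^esub> letter b \<otimes>\<^bsub>F\<^esub> inv\<^bsub>F\<^esub> (letter (a \<otimes> b))"
  by (simp add: br2_def X.free_xmod_bd_gen) (simp add: std_relator_def)

lemma hom_M_eqI:
  assumes "group H" "k \<in> hom M H" "k' \<in> hom M H"
    and "\<And>a b u. a \<in> carrier G \<Longrightarrow> b \<in> carrier G \<Longrightarrow> u \<in> carrier F \<Longrightarrow>
      k (act (br2 G (a, b)) u) = k' (act (br2 G (a, b)) u)"
    and "m \<in> carrier M"
  shows "k m = k' m"
  by (rule X.free_xmod_hom_eqI[OF assms(1-3) _ assms(5)]) (use assms(4) in \<open>auto simp: br2_def\<close>)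

lemma \<phi>_bd [simp]:
  assumes "m \<in> carrier M"
  shows "\<phi> (bd m) = \<one>"
proof -
  have "(\<phi> \<circ> bd) m = (\<lambda>_. \<one>) m"
    by (rule hom_M_eqI[OF is_group Group.hom_compose[OF bd_hom \<phi>_hom] _ _ assms])
      (auto intro!: homI simp: bd_act bd_br2)
  then show ?thesis by simp
qed

section \<open>The morphism \<open>h_1\<close> on the covering groupoid\<close>

lemma cov_val_closed_word:
  assumes "g \<in> carrier G" "snd ` set v \<subseteq> carrier G"
  shows "cov_val G g v \<in> carrier M"
  using assms
proof (induction v arbitrary: g)
  case (Cons x v)
  have "letter_val G (\<lambda>a. a) x \<in> carrier G"
    using Cons.prems by (auto simp: letter_val_def)
  with Cons show ?case by simp
qed simp

text \<open>\<open>h_1\<close> is a morphism of a groupoid and not a homomorphism on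
  \<open>F\<close>, so compatibility with cancellation is checked on words. The arrow
  \<open>(g, s^-1)\<close> is inverse to the arrow labelled \<open>s\<close> that starts at
  \<open>g s^-1\<close>; this is why a negative letter is evaluated at that base point.\<close>

lemma cov_val_push_letter:
  assumes "g \<in> carrier G" "snd x \<in> carrier G" "snd ` set v \<subseteq> carrier G"
  shows "cov_val G g (push_letter x v) = cov_val G g (x # v)"
proof (cases v)
  case (Cons y v')
  have c: "snd y \<in> carrier G" "cov_val G g v' \<in> carrier M"
    using assms Cons by (auto intro: cov_val_closed_word)
  have "cov_val G g (x # v) = cov_val G g v'" if "cancelling x y"
    using that assms c unfolding Cons
    by (auto simp: cancelling_def letter_val_def m_assoc X.M.m_assoc[symmetric])
  with Cons show ?thesis by (simp del: cov_val.simps)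
qed simp

lemma cov_val_foldr_push_letter:
  assumes "g \<in> carrier G" "snd ` set u \<subseteq> carrier G" "snd ` set v \<subseteq> carrier G"
  shows "cov_val G g (foldr push_letter u v) = cov_val G g u \<otimes>\<^bsub>M\<^esub> cov_val G (g \<otimes> \<phi> u) v"
  using assms(1,2)
proof (induction u arbitrary: g)
  case Nil
  then show ?case
    using assms(3) by (simp add: cov_val_closed_word)
next
  case (Cons x u)
  have x: "letter_val G (\<lambda>a. a) x \<in> carrier G" and u: "\<phi> u \<in> carrier G"
    using Cons.prems by (auto simp: letter_val_def intro!: eval_word_closed[of _ "carrier G"])
  have "snd ` set (foldr push_letter u v) \<subseteq> carrier G"
    using Cons.prems assms(3) set_foldr_push_letter[of u v] by fastforce
  then have "cov_val G g (foldr push_letter (x # u) v) = cov_val G g (x # foldr push_letter u v)"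
    using Cons.prems by (simp add: cov_val_push_letter del: cov_val.simps)
  then show ?case
    using Cons.prems x u assms(3) Cons.IH[of "g \<otimes> letter_val G (\<lambda>a. a) x"]
    by (simp add: X.M.m_assoc cov_val_closed_word m_assoc)
qed

lemma carrier_F: "u \<in> carrier F \<Longrightarrow> snd ` set u \<subseteq> carrier G"
  by (simp add: std_C1_def carrier_free_group)

lemma cov_val_closed [simp]: "g \<in> carrier G \<Longrightarrow> u \<in> carrier F \<Longrightarrow> cov_val G g u \<in> carrier M"
  by (simp add: carrier_F cov_val_closed_word)

lemma cov_val_mult:
  assumes "g \<in> carrier G" "u \<in> carrier F" "v \<in> carrier F"
  shows "cov_val G g (u \<otimes>\<^bsub>F\<^esub> v) = cov_val G g u \<otimes>\<^bsub>M\<^esub> cov_val G (g \<otimes> \<phi> u) v"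
  using assms cov_val_foldr_push_letter[of g u v]
  by (simp add: std_C1_def mult_free_group carrier_free_group)

lemma cov_val_one [simp]: "cov_val G g \<one>\<^bsub>F\<^esub> = \<one>\<^bsub>M\<^esub>"
  by (simp add: std_C1_def one_free_group)

lemma cov_val_letter: "g \<in> carrier G \<Longrightarrow> a \<in> carrier G \<Longrightarrow> cov_val G g (letter a) = br2 G (g, a)"
  by (simp add: letter_def)

lemma cov_val_inv:
  assumes "g \<in> carrier G" "u \<in> carrier F"
  shows "cov_val G g (inv\<^bsub>F\<^esub> u) = inv\<^bsub>M\<^esub> (cov_val G (g \<otimes> inv (\<phi> u)) u)"
proof -
  have "cov_val G g (inv\<^bsub>F\<^esub> u) \<otimes>\<^bsub>M\<^esub> cov_val G (g \<otimes> inv (\<phi> u)) u = \<one>\<^bsub>M\<^esub>"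
    using assms cov_val_mult[of g "inv\<^bsub>F\<^esub> u" u] by simp
  then show ?thesis
    using assms by (intro X.M.inv_equality[symmetric]) auto
qed

text \<open>A telescoping product: a letter \<open>s\<close> contributes
  \<open>[g] [s] [g s]^-1\<close>, whose last factor cancels the first factor of what follows. The
  result is the homotopy identity for \<open>h_1\<close> with \<open>h_0 g\<close> labelled
  \<open>[g]^-1\<close>.\<close>

lemma bd_cov_val:
  assumes "u \<in> carrier F" "g \<in> carrier G"
  shows "bd (cov_val G g u) = letter g \<otimes>\<^bsub>F\<^esub> u \<otimes>\<^bsub>F\<^esub> inv\<^bsub>F\<^esub> (letter (g \<otimes> \<phi> u))"
proof -
  have "u \<in> carrier (free_group (carrier G))"
    using assms by (simp add: std_C1_def)
  then show ?thesis
    using assms(2)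
  proof (induction u arbitrary: g rule: free_group_induct)
    case one
    then show ?case
      by (simp flip: std_C1_def)
  next
    case (letter s v)
    then have v: "v \<in> carrier F" "bd (cov_val G (g \<otimes> s) v) =
        letter (g \<otimes> s) \<otimes>\<^bsub>F\<^esub> v \<otimes>\<^bsub>F\<^esub> inv\<^bsub>F\<^esub> (letter (g \<otimes> s \<otimes> \<phi> v))"
      by (simp_all flip: std_C1_def)
    show ?case
      using letter(1,4) v
      by (simp add: cov_val_mult cov_val_letter bd_br2 F.m_assoc m_assoc F.mult_inv_cancel
          F.inv_mult_cancel flip: std_C1_def)
  next
    case (inv_letter s v)
    then have v: "v \<in> carrier F" "bd (cov_val G (g \<otimes> inv s) v) =
        letter (g \<otimes> inv s) \<otimes>\<^bsub>F\<^esub> v \<otimes>\<^bsub>F\<^esub> inv\<^bsub>F\<^esub> (letter (g \<otimes> inv s \<otimes> \<phi> v))"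
      by (simp_all flip: std_C1_def)
    show ?case
      using inv_letter(1,4) v
      by (simp add: cov_val_mult cov_val_inv cov_val_letter bd_br2 F.m_assoc m_assoc
          F.inv_mult_group F.mult_inv_cancel F.inv_mult_cancel flip: std_C1_def)
  qed
qed

section \<open>The kernel of \<open>bd\<close> as a right \<open>G\<close>-module\<close>

text \<open>By the Peiffer identity, conjugating \<open>m\<close> by \<open>z\<close> is acting on
  it by \<open>bd z\<close>, which is the unit.\<close>

lemma kernel_bd_central:
  assumes "z \<in> carrier M" "bd z = \<one>\<^bsub>F\<^esub>" "m \<in> carrier M"
  shows "z \<otimes>\<^bsub>M\<^esub> m = m \<otimes>\<^bsub>M\<^esub> z"
proof -
  have "m = inv\<^bsub>M\<^esub> z \<otimes>\<^bsub>M\<^esub> (m \<otimes>\<^bsub>M\<^esub> z)"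
    using act_bd[of m z] assms by (simp add: act_one X.M.m_assoc)
  then show ?thesis
    using assms by (metis X.M.inv_solve_left X.M.m_closed)
qed

text \<open>The same identity with the roles exchanged: \<open>bd m\<close> acts on \<open>z\<close>
  as conjugation by \<open>m\<close>, which fixes a central element.\<close>

lemma kernel_bd_act_bd:
  assumes "z \<in> carrier M" "bd z = \<one>\<^bsub>F\<^esub>" "m \<in> carrier M"
  shows "act z (bd m) = z"
  using assms kernel_bd_central[OF assms]
  by (simp add: act_bd X.M.m_assoc X.M.inv_mult_cancel)

lemma kernel_\<phi>_eq_image_bd:
  assumes "u \<in> carrier F" "\<phi> u = \<one>"
  shows "u \<in> bd ` carrier M"
proof
  \<comment> \<open>At base point one the telescoping product is \<open>[1] u [1]^-1\<close>, as
    \<open>\<phi> u = \<one>\<close>. Acting by \<open>letter \<one>\<close> removes this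
    conjugation.\<close>
  let ?m = "act (cov_val G \<one> u) (letter \<one>)"
  show "?m \<in> carrier M"
    using assms by simp
  show "u = bd ?m"
    using assms by (simp add: bd_act bd_cov_val F.m_assoc F.mult_inv_cancel F.inv_mult_cancel)
qed

text \<open>Two lifts of one element of \<open>G\<close> differ by an element of the kernel of
  \<phi>, hence by a boundary, and boundaries act trivially on \<open>ker bd\<close>. This is the
  action of \<open>G\<close> itself on \<open>ker bd\<close>.\<close>

lemma kernel_bd_act_cong:
  assumes "z \<in> carrier M" "bd z = \<one>\<^bsub>F\<^esub>" "u \<in> carrier F" "v \<in> carrier F" "\<phi> u = \<phi> v"
  shows "act z u = act z v"
proof -
  obtain m where m: "m \<in> carrier M" "u \<otimes>\<^bsub>F\<^esub> inv\<^bsub>F\<^esub> v = bd m"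
    using kernel_\<phi>_eq_image_bd[of "u \<otimes>\<^bsub>F\<^esub> inv\<^bsub>F\<^esub> v"] assms by auto
  have "u = (u \<otimes>\<^bsub>F\<^esub> inv\<^bsub>F\<^esub> v) \<otimes>\<^bsub>F\<^esub> v"
    using assms by (simp add: F.m_assoc)
  then have "act z u = act (act z (bd m)) v"
    using assms m by (simp add: act_act)
  then show ?thesis
    using assms m kernel_bd_act_bd by simp
qed

text \<open>The right-hand side of the homotopy identity for \<open>\<delta>\<^sub>3 h\<^sub>2\<close> at the base point \<open>g\<close>.\<close>

definition theta :: "'g \<Rightarrow> 'g std2 \<Rightarrow> 'g std2" where
  "theta g m = inv\<^bsub>M\<^esub> (cov_val G g (bd m)) \<otimes>\<^bsub>M\<^esub> act m (inv\<^bsub>F\<^esub> (letter g))"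

lemma theta_closed [simp]: "g \<in> carrier G \<Longrightarrow> m \<in> carrier M \<Longrightarrow> theta g m \<in> carrier M"
  by (simp add: theta_def)

text \<open>The element under the inverse and the second factor both have boundary
  \<open>[g] (bd m) [g]^-1\<close>, the former because \<open>\<phi> (bd m) = \<one>\<close> brings
  the telescoping product back to \<open>g\<close>.\<close>

lemma bd_theta: "g \<in> carrier G \<Longrightarrow> m \<in> carrier M \<Longrightarrow> bd (theta g m) = \<one>\<^bsub>F\<^esub>"
  by (simp add: theta_def bd_act bd_cov_val)

lemma theta_mult:
  assumes "g \<in> carrier G" "m \<in> carrier M" "n \<in> carrier M"
  shows "theta g (m \<otimes>\<^bsub>M\<^esub> n) = theta g m \<otimes>\<^bsub>M\<^esub> theta g n"
proof -
  let ?c = "inv\<^bsub>M\<^esub> (cov_val G g (bd n))"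
  have "theta g (m \<otimes>\<^bsub>M\<^esub> n) = ?c \<otimes>\<^bsub>M\<^esub> theta g m \<otimes>\<^bsub>M\<^esub> act n (inv\<^bsub>F\<^esub> (letter g))"
    using assms by (simp add: theta_def cov_val_mult act_mult X.M.inv_mult_group X.M.m_assoc)
  \<comment> \<open>Inversion has put the factor for \<open>n\<close> in front; centrality of
    \<open>theta g m\<close> moves it back next to the translate of \<open>n\<close>.\<close>
  also have "?c \<otimes>\<^bsub>M\<^esub> theta g m = theta g m \<otimes>\<^bsub>M\<^esub> ?c"
    using assms by (intro kernel_bd_central[symmetric]) (auto simp: bd_theta)
  finally show ?thesis
    using assms by (simp add: theta_def X.M.m_assoc)
qed

lemma theta_hom: "g \<in> carrier G \<Longrightarrow> theta g \<in> hom M M"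
  by (rule homI) (simp_all add: theta_mult)

text \<open>Moving the base point along \<open>u\<close> conjugates both factors by the same element
  \<open>c\<close>, the value of \<open>h_1\<close> at \<open>(g, u)\<close>: the first since
  \<open>h_1\<close> is a groupoid morphism, the second by the Peiffer identity, as
  \<open>bd c\<close> is \<open>[g] u [g \<phi>(u)]^-1\<close>. A central element is fixed by this
  conjugation.\<close>

lemma theta_act:
  assumes g: "g \<in> carrier G" and m: "m \<in> carrier M" and u: "u \<in> carrier F"
  shows "theta (g \<otimes> \<phi> u) (act m u) = theta g m"
proof -
  define c where "c = cov_val G g u"
  define A where "A = cov_val G g (bd m)"
  define m' where "m' = act m (inv\<^bsub>F\<^esub> (letter g))"
  have cl: "c \<in> carrier M" "A \<in> carrier M" "m' \<in> carrier M"
    using assms by (auto simp: c_def A_def m'_def)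
  have "cov_val G (g \<otimes> \<phi> u) (bd (act m u)) = inv\<^bsub>M\<^esub> c \<otimes>\<^bsub>M\<^esub> A \<otimes>\<^bsub>M\<^esub> c"
    using assms by (simp add: bd_act cov_val_mult cov_val_inv m_assoc c_def A_def)
  moreover have "act (act m u) (inv\<^bsub>F\<^esub> (letter (g \<otimes> \<phi> u))) = inv\<^bsub>M\<^esub> c \<otimes>\<^bsub>M\<^esub> m' \<otimes>\<^bsub>M\<^esub> c"
  proof -
    have "act (act m u) (inv\<^bsub>F\<^esub> (letter (g \<otimes> \<phi> u))) = act m' (bd c)"
      using assms
      by (simp add: c_def m'_def bd_cov_val act_act F.m_assoc[symmetric])
    then show ?thesis
      using cl by (simp add: act_bd)
  qed
  ultimately have "theta (g \<otimes> \<phi> u) (act m u) = inv\<^bsub>M\<^esub> c \<otimes>\<^bsub>M\<^esub> (theta g m \<otimes>\<^bsub>M\<^esub> c)"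
    using cl
    by (simp add: theta_def A_def[symmetric] m'_def[symmetric] X.M.inv_mult_group X.M.m_assoc
        X.M.mult_inv_cancel)
  also have "theta g m \<otimes>\<^bsub>M\<^esub> c = c \<otimes>\<^bsub>M\<^esub> theta g m"
    using assms cl by (intro kernel_bd_central) (auto simp: bd_theta)
  finally show ?thesis
    using assms cl by (simp add: X.M.m_assoc[symmetric])
qed

end

section \<open>The alternating-sum boundary and the shift\<close>

text \<open>Also evaluated on \<open>tuples G 3\<close>, with values in an auxiliary free module on
  pairs. There it is not a boundary of the resolution, but it carries the homotopy identity in
  dimension 3, by way of \<open>std_shift_bd_gen_3\<close>.\<close>

definition std_bd_gen :: "('g, 'x) monoid_scheme \<Rightarrow> 'g list \<Rightarrow> 'g stdn" where
  "std_bd_gen G xs =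
     free_mod_act G (br G (tl xs)) (inv\<^bsub>G\<^esub> (xs ! 0))
     + (\<Sum>i = 1..length xs - 1. frag_cmul ((- 1) ^ i)
          (br G (take (i - 1) xs @ [xs ! (i - 1) \<otimes>\<^bsub>G\<^esub> xs ! i] @ drop (i + 1) xs)))
     + frag_cmul ((- 1) ^ length xs) (br G (butlast xs))"

definition std_bd :: "('g, 'x) monoid_scheme \<Rightarrow> 'g stdn \<Rightarrow> 'g stdn" where
  "std_bd G = frag_extend (\<lambda>(xs, k). free_mod_act G (std_bd_gen G xs) k)"

definition std_shift :: "('g, 'x) monoid_scheme \<Rightarrow> 'g \<Rightarrow> 'g stdn \<Rightarrow> 'g stdn" where
  "std_shift G g = frag_extend (\<lambda>(xs, k). br G ((g \<otimes>\<^bsub>G\<^esub> inv\<^bsub>G\<^esub> k) # xs))"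

lemma std_bd_of: "std_bd G (frag_of (xs, k)) = free_mod_act G (std_bd_gen G xs) k"
  by (simp add: std_bd_def)

lemma std_bd_diff: "std_bd G (c - d) = std_bd G c - std_bd G d"
  by (simp add: std_bd_def frag_extend_diff)

lemma std_bd_add: "std_bd G (c + d) = std_bd G c + std_bd G d"
  by (simp add: std_bd_def frag_extend_add)

lemma std_bd_0 [simp]: "std_bd G 0 = 0"
  by (simp add: std_bd_def)

lemma std_shift_of: "std_shift G g (frag_of (xs, k)) = br G ((g \<otimes>\<^bsub>G\<^esub> inv\<^bsub>G\<^esub> k) # xs)"
  by (simp add: std_shift_def)

lemma std_shift_diff: "std_shift G g (c - d) = std_shift G g c - std_shift G g d"
  by (simp add: std_shift_def frag_extend_diff)

lemma std_shift_add: "std_shift G g (c + d) = std_shift G g c + std_shift G g d"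
  by (simp add: std_shift_def frag_extend_add)

lemma std_shift_0 [simp]: "std_shift G g 0 = 0"
  by (simp add: std_shift_def)

context group
begin

abbreviation C :: "nat \<Rightarrow> 'a stdn monoid" where
  "C n \<equiv> free_mod G (tuples G n)"

lemma br_eq: "br G xs = frag_of (xs, \<one>)"
  by (simp add: br_def free_mod_gen_def)

lemma br_closed [simp]: "br G xs \<in> carrier (C n) \<longleftrightarrow> xs \<in> tuples G n"
  by (simp add: br_eq carrier_free_mod)

lemma Cons_tuples [simp]: "a # xs \<in> tuples G (Suc n) \<longleftrightarrow> a \<in> carrier G \<and> xs \<in> tuples G n"
  by (auto simp: tuples_def)

lemma std_shift_br: "g \<in> carrier G \<Longrightarrow> std_shift G g (br G xs) = br G (g # xs)"
  by (simp add: br_eq std_shift_of)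

lemma std_bd_br:
  "std_bd_gen G xs \<in> carrier (C n) \<Longrightarrow> std_bd G (br G xs) = std_bd_gen G xs"
  by (simp add: br_eq std_bd_of free_mod_act_one)

lemma free_mod_add_closed:
  "c \<in> carrier (free_mod G S) \<Longrightarrow> d \<in> carrier (free_mod G S) \<Longrightarrow> c + d \<in> carrier (free_mod G S)"
  using keys_add[of c d] by (auto simp: carrier_free_mod)

lemma free_mod_cmul_closed:
  "c \<in> carrier (free_mod G S) \<Longrightarrow> frag_cmul z c \<in> carrier (free_mod G S)"
  using keys_cmul[of z c] by (auto simp: carrier_free_mod)

lemma free_mod_sum_closed:
  "(\<And>i. i \<in> I \<Longrightarrow> f i \<in> carrier (free_mod G S)) \<Longrightarrow> sum f I \<in> carrier (free_mod G S)"
  unfolding free_mod_def by (rule sum_closed_free_Abelian_group)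

lemma std_bd_gen_closed:
  assumes "xs \<in> tuples G (Suc n)"
  shows "std_bd_gen G xs \<in> carrier (C n)"
proof -
  have len: "length xs = Suc n" and sub: "set xs \<subseteq> carrier G"
    using assms by (auto simp: tuples_def)
  have nth: "xs ! i \<in> carrier G" if "i < Suc n" for i
    using that len sub nth_mem by auto
  have "tl xs \<in> tuples G n" "butlast xs \<in> tuples G n"
    using len sub by (auto simp: tuples_def dest: in_set_butlastD list.set_sel(2)[rotated])
  moreover have "take (i - 1) xs @ [xs ! (i - 1) \<otimes> xs ! i] @ drop (i + 1) xs \<in> tuples G n"
    if "i \<in> {1..n}" for i
    using that len sub nth[of "i - 1"] nth[of i]
    by (auto simp: tuples_def dest: in_set_takeD in_set_dropD)
  ultimately show ?thesis
    unfolding std_bd_gen_def using nth[of 0]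
    by (intro free_mod_add_closed free_mod_sum_closed free_mod_cmul_closed free_mod_act_closed)
      (auto simp: len)
qed

lemma std_bd_closed:
  assumes "c \<in> carrier (C (Suc n))"
  shows "std_bd G c \<in> carrier (C n)"
  using assms
  by (induction rule: free_mod_induct)
    (auto simp: std_bd_of std_bd_diff free_mod_diff_closed std_bd_gen_closed free_mod_act_closed,
     simp add: carrier_free_mod)

lemma std_bd_act:
  assumes "c \<in> carrier (C (Suc n))" "h \<in> carrier G"
  shows "std_bd G (free_mod_act G c h) = free_mod_act G (std_bd G c) h"
  using assms(1)
  by (induction rule: free_mod_induct)
    (use assms(2) in \<open>auto simp: std_bd_of std_bd_diff free_mod_act_diff
        free_mod_act_act[OF std_bd_gen_closed]\<close>)

lemma std_shift_closed:
  assumes "c \<in> carrier (C n)" "g \<in> carrier G"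
  shows "std_shift G g c \<in> carrier (C (Suc n))"
  using assms(1)
  by (induction rule: free_mod_induct)
    (use assms(2) in \<open>auto simp: std_shift_of std_shift_diff free_mod_diff_closed\<close>,
     simp add: carrier_free_mod)

text \<open>The element \<open>c^h\<close> over \<open>g\<close> is the translate of
  \<open>c\<close> over \<open>g h^-1\<close>, so this is the invariance of \<open>h_n\<close> under
  the groupoid.\<close>

lemma std_shift_act:
  assumes "c \<in> carrier (C n)" "g \<in> carrier G" "h \<in> carrier G"
  shows "std_shift G g (free_mod_act G c h) = std_shift G (g \<otimes> inv h) c"
  using assms(1)
  by (induction rule: free_mod_induct)
    (use assms(2,3) in \<open>auto simp: std_shift_of std_shift_diff free_mod_act_diff inv_mult_group m_assoc\<close>)

lemma std_shift_cmul: "std_shift G g (frag_cmul z c) = frag_cmul z (std_shift G g c)"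
  by (simp add: std_shift_def frag_extend_cmul)

lemma std_shift_sum: "finite I \<Longrightarrow> std_shift G g (sum f I) = (\<Sum>i\<in>I. std_shift G g (f i))"
  by (simp add: std_shift_def frag_extend_sum o_def)

text \<open>The \<open>i\<close>-th face of \<open>xs\<close> reappears as face \<open>i + 1\<close> of \<open>a # xs\<close> with the opposite sign, so that
  only the zeroth face \<open>xs\<close> survives.\<close>

lemma std_bd_gen_Cons:
  assumes a: "a \<in> carrier G" and xs: "xs \<in> tuples G (Suc n)"
  shows "std_bd_gen G (a # xs) = free_mod_act G (br G xs) (inv a) - std_shift G a (std_bd_gen G xs)"
proof -
  obtain x ys where x: "xs = x # ys" "x \<in> carrier G" "ys \<in> tuples G n"
    using xs by (cases xs) (auto simp: tuples_def)
  then have len: "length xs = Suc n"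
    using xs by (simp add: tuples_def)
  define f where "f zs i = frag_cmul ((- 1) ^ i)
      (br G (take (i - 1) zs @ [zs ! (i - 1) \<otimes> zs ! i] @ drop (i + 1) zs))" for zs i
  have "std_shift G a (free_mod_act G (br G (tl xs)) (inv (xs ! 0))) = br G ((a \<otimes> x) # ys)"
    using a x by (subst std_shift_act[of _ n]) (simp_all add: std_shift_br)
  then have shift: "std_shift G a (std_bd_gen G xs) = br G ((a \<otimes> x) # ys)
      + (\<Sum>i = 1..n. std_shift G a (f xs i)) + frag_cmul ((- 1) ^ Suc n) (br G (a # butlast xs))"
    using a len
    by (simp add: std_bd_gen_def f_def std_shift_add std_shift_sum std_shift_cmul std_shift_br)
  have step: "f (a # xs) (Suc i) = - std_shift G a (f xs i)" if "i \<in> {1..n}" for i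
    using that a by (cases i) (simp_all add: f_def std_shift_cmul std_shift_br)
  have "(\<Sum>i = 1..Suc n. f (a # xs) i) = f (a # xs) 1 + (\<Sum>i = 1..n. f (a # xs) (Suc i))"
    by (simp add: sum.atLeast_Suc_atMost sum.shift_bounds_cl_Suc_ivl del: sum.cl_ivl_Suc)
  also have "(\<Sum>i = 1..n. f (a # xs) (Suc i)) = - (\<Sum>i = 1..n. std_shift G a (f xs i))"
    by (simp add: step sum_negf)
  also have "f (a # xs) 1 = - br G ((a \<otimes> x) # ys)"
    by (simp add: f_def x)
  finally have "std_bd_gen G (a # xs) = free_mod_act G (br G xs) (inv a)
      + (- br G ((a \<otimes> x) # ys) + - (\<Sum>i = 1..n. std_shift G a (f xs i)))
      + frag_cmul ((- 1) ^ Suc (Suc n)) (br G (butlast (a # xs)))"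
    by (simp add: std_bd_gen_def len f_def del: butlast.simps sum.cl_ivl_Suc)
  moreover have "butlast (a # xs) = a # butlast xs"
    using len by auto
  moreover have "frag_cmul ((- 1) ^ Suc (Suc n)) c = - frag_cmul ((- 1) ^ Suc n) c" for c :: "'a stdn"
    by simp
  ultimately show ?thesis
    by (simp only: shift) simp
qed

text \<open>The recursion \<open>std_bd_gen_Cons\<close> extended to translates: over
  \<open>g\<close>, the symbol \<open>(xs, k)\<close> is shifted like \<open>xs\<close> over
  \<open>g k^-1\<close>, and the inverse of that base point is \<open>k g^-1\<close>.\<close>

lemma std_bd_shift:
  assumes "c \<in> carrier (C (Suc n))" "g \<in> carrier G"
  shows "std_bd G (std_shift G g c) = free_mod_act G c (inv g) - std_shift G g (std_bd G c)"
  using assms(1)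
proof (induction rule: free_mod_induct)
  case (gen xs k)
  let ?a = "g \<otimes> inv k"
  have a: "?a \<in> carrier G"
    using gen assms by simp
  have "std_bd G (std_shift G g (frag_of (xs, k))) = std_bd_gen G (?a # xs)"
    using a gen(1) by (simp add: std_shift_of std_bd_br[OF std_bd_gen_closed])
  also have "\<dots> = free_mod_act G (br G xs) (inv ?a) - std_shift G ?a (std_bd_gen G xs)"
    by (rule std_bd_gen_Cons[OF a gen(1)])
  also have "std_shift G ?a (std_bd_gen G xs) = std_shift G g (std_bd G (frag_of (xs, k)))"
    using gen assms by (simp add: std_bd_of std_shift_act[OF std_bd_gen_closed])
  finally show ?case
    using gen assms by (simp add: br_eq inv_mult_group)
qed (simp_all add: std_shift_diff std_bd_diff free_mod_act_diff)

end

context standard_resolution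
begin

section \<open>The map \<open>h_2\<close>\<close>

definition h2_val :: "'g \<Rightarrow> ('g \<times> 'g) \<times> 'g word \<Rightarrow> 'g stdn" where
  "h2_val g = (\<lambda>((b, c), u). br G [g \<otimes> inv (\<phi> u), b, c])"

definition h2c :: "'g \<Rightarrow> 'g std2 \<Rightarrow> 'g stdn" where
  "h2c g K = the_elem (eval_word (C 3) (h2_val g) ` K)"

sublocale C: comm_group "C n" for n
  by (rule comm_group_free_mod)

lemma tuples_3: "[a, b, c] \<in> tuples G 3 \<longleftrightarrow> a \<in> carrier G \<and> b \<in> carrier G \<and> c \<in> carrier G"
  by (auto simp: tuples_def)

lemma tuples_3E:
  assumes "xs \<in> tuples G 3"
  obtains a b c where "xs = [a, b, c]" "a \<in> carrier G" "b \<in> carrier G" "c \<in> carrier G"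
  using assms by (auto simp: tuples_def numeral_3_eq_3 length_Suc_conv)

lemma h2_val_closed:
  "g \<in> carrier G \<Longrightarrow> h2_val g \<in> (carrier G \<times> carrier G) \<times> carrier F \<rightarrow> carrier (C 3)"
  by (auto simp: h2_val_def tuples_3)

lemma h2_word_hom: "g \<in> carrier G \<Longrightarrow> eval_word (C 3) (h2_val g) \<in> hom X.P (C 3)"
  unfolding pre_group_def by (rule C.eval_word_hom[OF h2_val_closed])

lemma h2_word_act:
  assumes "g \<in> carrier G" "u \<in> carrier F" "p \<in> carrier X.P"
  shows "eval_word (C 3) (h2_val g) (pre_act F p u) = eval_word (C 3) (h2_val (g \<otimes> inv (\<phi> u))) p"
proof -
  have "eval_word (C 3) (h2_val g) (pre_act F p u) = id (eval_word (C 3) (h2_val (g \<otimes> inv (\<phi> u))) p)"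
  proof (rule X.eval_word_pre_act[OF C.is_group _ h2_val_closed h2_val_closed _ assms(2,3)])
    show "id \<in> hom (C 3) (C 3)"
      by (auto simp: hom_def)
  qed (use assms in \<open>auto simp: h2_val_def inv_mult_group m_assoc\<close>)
  then show ?thesis by simp
qed

text \<open>Boundaries lie in the kernel of \<phi>, so translating \<open>q\<close> by one does not
  change the base point and hence not the value. Conjugation in the abelian group \<open>C 3\<close>
  changes nothing either.\<close>

lemma h2_word_descends:
  assumes "g \<in> carrier G"
  shows "X.descends (C 3) (eval_word (C 3) (h2_val g))"
  unfolding X.descends_def
proof (intro conjI ballI h2_word_hom[OF assms])
  fix p q assume pq: "p \<in> carrier X.P" "q \<in> carrier X.P"
  then have "\<phi> (pre_bd F (std_relator G) p) = \<one>"
    using \<phi>_bd[of "X.cls p"] by (simp add: X.free_xmod_bd_cls)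
  moreover have "eval_word (C 3) (h2_val g) p \<in> carrier (C 3)" "eval_word (C 3) (h2_val g) q \<in> carrier (C 3)"
    using h2_word_hom[OF assms] pq by (auto simp: hom_def)
  ultimately show "eval_word (C 3) (h2_val g) (pre_act F q (pre_bd F (std_relator G) p)) =
      inv\<^bsub>C 3\<^esub> (eval_word (C 3) (h2_val g) p) \<otimes>\<^bsub>C 3\<^esub> eval_word (C 3) (h2_val g) q \<otimes>\<^bsub>C 3\<^esub>
      eval_word (C 3) (h2_val g) p"
    using assms pq by (simp add: h2_word_act)
qed

lemma h2c_hom: "g \<in> carrier G \<Longrightarrow> h2c g \<in> hom M (C 3)"
  using X.descends_hom[OF C.is_group h2_word_descends] by (simp add: h2c_def[abs_def])

lemma h2c_closed [simp]: "g \<in> carrier G \<Longrightarrow> m \<in> carrier M \<Longrightarrow> h2c g m \<in> carrier (C 3)"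
  using h2c_hom by (auto simp: hom_def)

lemma h2c_act:
  assumes "g \<in> carrier G" "u \<in> carrier F" "m \<in> carrier M"
  shows "h2c g (act m u) = h2c (g \<otimes> inv (\<phi> u)) m"
proof -
  obtain p where "m = X.cls p" "p \<in> carrier X.P"
    using assms(3) by (auto simp: X.carrier_free_xmod)
  then show ?thesis
    using assms
    by (simp add: h2c_def X.free_xmod_act_cls X.descends_cls[OF C.is_group h2_word_descends] h2_word_act)
qed

lemma h2c_br2:
  assumes "g \<in> carrier G" "b \<in> carrier G" "c \<in> carrier G"
  shows "h2c g (br2 G (b, c)) = br G [g, b, c]"
proof -
  have "h2_val g ((b, c), \<one>\<^bsub>F\<^esub>) \<in> carrier (C 3)"
    using h2_val_closed[OF assms(1)] assms by auto
  then show ?thesis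
    using assms
    by (simp add: h2c_def br2_def free_xmod_gen_def X.descends_cls[OF C.is_group h2_word_descends]
        C.eval_word_letter) (simp add: h2_val_def)
qed

section \<open>The boundary \<open>delta_3\<close>\<close>

definition d3_gen :: "'g list \<Rightarrow> 'g std2" where
  "d3_gen xs = theta (xs ! 0) (br2 G (xs ! 1, xs ! 2))"

lemma d3_gen_closed: "xs \<in> tuples G 3 \<Longrightarrow> d3_gen xs \<in> carrier M"
  by (auto simp: d3_gen_def elim!: tuples_3E)

lemma bd_d3_gen: "xs \<in> tuples G 3 \<Longrightarrow> bd (d3_gen xs) = \<one>\<^bsub>F\<^esub>"
  by (auto simp: d3_gen_def bd_theta elim!: tuples_3E)

lemma theta_br2:
  assumes "a \<in> carrier G" "b \<in> carrier G" "c \<in> carrier G"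
  shows "theta a (br2 G (b, c)) =
    br2 G (a, b \<otimes> c) \<otimes>\<^bsub>M\<^esub> inv\<^bsub>M\<^esub> (br2 G (a \<otimes> b, c)) \<otimes>\<^bsub>M\<^esub> inv\<^bsub>M\<^esub> (br2 G (a, b)) \<otimes>\<^bsub>M\<^esub>
    act (br2 G (b, c)) (inv\<^bsub>F\<^esub> (letter a))"
proof -
  \<comment> \<open>The boundary of \<open>[b, c]\<close> lifts to a loop at \<open>a\<close>
    through \<open>a b\<close> and \<open>a b c\<close>. Its last edge is the inverse of the arrow
    labelled \<open>[b c]\<close> starting at \<open>a\<close>, whence the factor
    \<open>[a, b c]\<close>.\<close>
  have "a \<otimes> b \<otimes> c \<otimes> inv (b \<otimes> c) = a"
    using assms by (simp add: m_assoc)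
  then have "cov_val G a (bd (br2 G (b, c))) =
      br2 G (a, b) \<otimes>\<^bsub>M\<^esub> br2 G (a \<otimes> b, c) \<otimes>\<^bsub>M\<^esub> inv\<^bsub>M\<^esub> (br2 G (a, b \<otimes> c))"
    using assms by (simp add: bd_br2 cov_val_mult cov_val_inv cov_val_letter m_assoc)
  then show ?thesis
    using assms by (simp add: theta_def X.M.inv_mult_group X.M.m_assoc)
qed

text \<open>\<open>M\<close> need not be abelian, so the universal property of \<open>C 3\<close> is
  applied with target \<open>ker bd\<close>, which is abelian by \<open>kernel_bd_central\<close>.
  Here \<open>letter k\<close> is just one lift of \<open>k\<close>.\<close>

lemma ex_d3:
  "\<exists>d. d \<in> hom (C 3) M \<and> (\<forall>c\<in>carrier (C 3). bd (d c) = \<one>\<^bsub>F\<^esub>) \<and>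
     (\<forall>xs\<in>tuples G 3. \<forall>k\<in>carrier G. d (frag_of (xs, k)) = act (d3_gen xs) (letter k))"
proof -
  let ?K = "M\<lparr>carrier := kernel M F bd\<rparr>"
  have "group ?K"
    by (rule X.M.subgroup_imp_group[OF bd.subgroup_kernel])
  then interpret K: comm_group ?K
  proof (rule group.group_comm_groupI)
    fix x y assume "x \<in> carrier ?K" "y \<in> carrier ?K"
    then show "x \<otimes>\<^bsub>?K\<^esub> y = y \<otimes>\<^bsub>?K\<^esub> x"
      using kernel_bd_central[of x y] by (simp add: kernel_def)
  qed
  have sub: "(\<lambda>(xs, k). act (d3_gen xs) (letter k)) ` (tuples G 3 \<times> carrier G) \<subseteq> carrier ?K"
    by (auto simp: kernel_def d3_gen_closed bd_d3_gen bd_act)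
  obtain d where d: "d \<in> hom (C 3) ?K"
    "\<And>x. x \<in> tuples G 3 \<times> carrier G \<Longrightarrow> d (frag_of x) = (\<lambda>(xs, k). act (d3_gen xs) (letter k)) x"
    unfolding free_mod_def by (rule K.free_Abelian_group_universal[OF sub]) blast
  have "d c \<in> carrier M" "bd (d c) = \<one>\<^bsub>F\<^esub>" if "c \<in> carrier (C 3)" for c
    using hom_carrier[OF d(1)] that by (auto simp: kernel_def)
  moreover have "d (c \<otimes>\<^bsub>C 3\<^esub> c') = d c \<otimes>\<^bsub>M\<^esub> d c'"
    if "c \<in> carrier (C 3)" "c' \<in> carrier (C 3)" for c c'
    using hom_mult[OF d(1) that] by simp
  moreover have "d (frag_of (xs, k)) = act (d3_gen xs) (letter k)"
    if "xs \<in> tuples G 3" "k \<in> carrier G" for xs k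
    using d(2)[of "(xs, k)"] that by simp
  ultimately show ?thesis
    by (intro exI[of _ d] conjI ballI homI)
qed

definition d3c :: "'g stdn \<Rightarrow> 'g std2" where
  "d3c = (SOME d. d \<in> hom (C 3) M \<and> (\<forall>c\<in>carrier (C 3). bd (d c) = \<one>\<^bsub>F\<^esub>) \<and>
     (\<forall>xs\<in>tuples G 3. \<forall>k\<in>carrier G. d (frag_of (xs, k)) = act (d3_gen xs) (letter k)))"

lemma d3c_hom: "d3c \<in> hom (C 3) M"
  and bd_d3c: "c \<in> carrier (C 3) \<Longrightarrow> bd (d3c c) = \<one>\<^bsub>F\<^esub>"
  and d3c_of: "xs \<in> tuples G 3 \<Longrightarrow> k \<in> carrier G \<Longrightarrow> d3c (frag_of (xs, k)) = act (d3_gen xs) (letter k)"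
  using someI_ex[OF ex_d3] unfolding d3c_def by blast+

lemma d3c_closed [simp]: "c \<in> carrier (C 3) \<Longrightarrow> d3c c \<in> carrier M"
  using d3c_hom by (auto simp: hom_def)

text \<open>The generator is the symbol with group element \<open>\<one>\<close>, whose chosen lift
  \<open>letter \<one>\<close> is not the unit of \<open>F\<close> but acts trivially on
  \<open>ker bd\<close>.\<close>

lemma d3c_br: "xs \<in> tuples G 3 \<Longrightarrow> d3c (br G xs) = d3_gen xs"
  using kernel_bd_act_cong[of "d3_gen xs" "letter \<one>" "\<one>\<^bsub>F\<^esub>"]
  by (simp add: br_eq d3c_of act_one d3_gen_closed bd_d3_gen)

lemma free_mod_act_hom: "h \<in> carrier G \<Longrightarrow> (\<lambda>c. free_mod_act G c h) \<in> hom (C n) (C n)"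
  using right_module_free_mod[of "tuples G n"] by (simp add: right_module_def right_action_def)

lemma d3c_act:
  assumes "c \<in> carrier (C 3)" "u \<in> carrier F"
  shows "d3c (free_mod_act G c (\<phi> u)) = act (d3c c) u"
proof -
  have u: "\<phi> u \<in> carrier G"
    using assms(2) by simp
  have "(d3c \<circ> (\<lambda>c. free_mod_act G c (\<phi> u))) c = ((\<lambda>m. act m u) \<circ> d3c) c"
  proof (rule free_mod_hom_eqI[OF Group.hom_compose[OF free_mod_act_hom[OF u] d3c_hom]
        Group.hom_compose[OF d3c_hom act_hom[OF assms(2)]] X.M.is_group _ assms(1)])
    fix xs k assume "xs \<in> tuples G 3" "k \<in> carrier G"
    then show "(d3c \<circ> (\<lambda>c. free_mod_act G c (\<phi> u))) (frag_of (xs, k)) = ((\<lambda>m. act m u) \<circ> d3c) (frag_of (xs, k))"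
      \<comment> \<open>The letter of a product and the product of a letter with \<open>u\<close>
        are two lifts of the same element of \<open>G\<close>.\<close>
      using assms(2) kernel_bd_act_cong[of "d3_gen xs" "letter (k \<otimes> \<phi> u)" "letter k \<otimes>\<^bsub>F\<^esub> u"]
      by (simp add: d3c_of d3_gen_closed bd_d3_gen act_act)
  qed
  then show ?thesis by simp
qed

text \<open>Both sides are homomorphisms invariant under the groupoid, so only untranslated
  generators matter, and there the equation is the definition of \<open>d3_gen\<close>.\<close>

lemma d3c_h2c:
  assumes "m \<in> carrier M" "g \<in> carrier G"
  shows "d3c (h2c g m) = theta g m"
proof -
  have "(d3c \<circ> h2c g) m = theta g m"
  proof (rule hom_M_eqI[OF X.M.is_group Group.hom_compose[OF h2c_hom d3c_hom] theta_hom _ assms(1)])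
    fix a b u assume ab: "a \<in> carrier G" "b \<in> carrier G" "u \<in> carrier F"
    then have "theta g (act (br2 G (a, b)) u) = theta (g \<otimes> inv (\<phi> u)) (br2 G (a, b))"
      using assms(2) theta_act[of "g \<otimes> inv (\<phi> u)" "br2 G (a, b)" u] by (simp add: m_assoc)
    then show "(d3c \<circ> h2c g) (act (br2 G (a, b)) u) = theta g (act (br2 G (a, b)) u)"
      using ab assms(2) by (simp add: h2c_act h2c_br2 d3c_br tuples_3 d3_gen_def)
  qed (use assms in auto)
  then show ?thesis by simp
qed

section \<open>Linking \<open>delta_3\<close> to the alternating sums\<close>

text \<open>After applying \<open>h_2\<close> the four factors of \<open>delta_3 [a, b, c]\<close>
  become commuting summands, and they are the shifts of the four faces of \<open>[a, b, c]\<close>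
  with the same signs.\<close>

lemma std_shift_bd_gen_3:
  assumes "xs \<in> tuples G 3" "g \<in> carrier G"
  shows "std_shift G g (std_bd_gen G xs) = h2c g (d3_gen xs)"
proof -
  obtain a b c where x: "xs = [a, b, c]" "a \<in> carrier G" "b \<in> carrier G" "c \<in> carrier G"
    using assms(1) by (rule tuples_3E)
  have h_mult: "h2c g (m \<otimes>\<^bsub>M\<^esub> n) = h2c g m + h2c g n" if "m \<in> carrier M" "n \<in> carrier M" for m n
    using hom_mult[OF h2c_hom[OF assms(2)] that] by simp
  have h_inv: "h2c g (inv\<^bsub>M\<^esub> m) = - h2c g m" if "m \<in> carrier M" for m
    using hom_inv[OF h2c_hom[OF assms(2)] X.M.is_group C.is_group that] that assms(2) by simp
  have "std_shift G g (free_mod_act G (br G [b, c]) (inv a)) = br G [g \<otimes> a, b, c]"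
  proof (subst std_shift_act[of _ 2])
    show "br G [b, c] \<in> carrier (C 2)"
      using x by (simp only: br_closed) (simp add: tuples_def)
  qed (use x assms(2) in \<open>simp_all add: std_shift_br\<close>)
  moreover have "{1..2} = {1, 2 :: nat}"
    by auto
  ultimately have "std_shift G g (std_bd_gen G xs) =
      br G [g \<otimes> a, b, c] - br G [g, a \<otimes> b, c] + br G [g, a, b \<otimes> c] - br G [g, a, b]"
    using assms(2) x
    by (simp add: std_bd_gen_def std_shift_add std_shift_diff std_shift_cmul std_shift_br)
  moreover have "h2c g (d3_gen xs) =
      br G [g, a, b \<otimes> c] - br G [g, a \<otimes> b, c] - br G [g, a, b] + br G [g \<otimes> a, b, c]"
    using x assms(2)
    by (simp add: d3_gen_def theta_br2 h_mult h_inv h2c_act h2c_br2)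
  ultimately show ?thesis
    by simp
qed

text \<open>This is \<open>std_bd_shift\<close> in dimension 3, its last term passing through the
  auxiliary module of pairs being replaced by the genuine one through \<open>C_2\<close>.\<close>

lemma std_bd_shift_3:
  assumes "c \<in> carrier (C 3)" "g \<in> carrier G"
  shows "std_bd G (std_shift G g c) = free_mod_act G c (inv g) - h2c g (d3c c)"
  using assms(1)
proof (induction rule: free_mod_induct)
  case zero
  have "h2c g (d3c 0) = 0"
    using hom_one[OF d3c_hom C.is_group X.M.is_group] hom_one[OF h2c_hom X.M.is_group C.is_group] assms
    by simp
  then show ?case by simp
next
  case (gen xs k)
  then have "std_shift G g (std_bd G (frag_of (xs, k))) = h2c g (d3c (frag_of (xs, k)))"
    using assms(2) std_bd_gen_closed[of xs 2]
    by (simp add: std_bd_of std_shift_act[of _ 2] std_shift_bd_gen_3 d3c_of h2c_act d3_gen_closed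
        numeral_3_eq_3)
  then show ?case
    using std_bd_shift[of "frag_of (xs, k)" 2 g] gen assms(2)
    by (simp add: carrier_free_mod numeral_3_eq_3)
next
  case (diff c d)
  have "h2c g (d3c (c - d)) = h2c g (d3c c) - h2c g (d3c d)"
    using hom_free_mod_diff[OF Group.hom_compose[OF d3c_hom h2c_hom[OF assms(2)]] C.is_group diff(1,2)]
      diff(1,2) assms(2) by simp
  with diff show ?case
    by (simp add: std_shift_diff std_bd_diff free_mod_act_diff)
qed

lemma free_mod_gen_eq_act_br: "k \<in> carrier G \<Longrightarrow> frag_of (xs, k) = free_mod_act G (br G xs) k"
  by (simp add: br_eq)

section \<open>Consecutive boundaries compose to zero\<close>

lemma d3c_std_bd:
  assumes "c \<in> carrier (C 4)"
  shows "d3c (std_bd G c) = \<one>\<^bsub>M\<^esub>"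
  using assms
proof (induction rule: free_mod_induct)
  case zero
  show ?case
    using hom_one[OF d3c_hom C.is_group X.M.is_group] by simp
next
  case (gen xs k)
  obtain a ys where xs: "xs = a # ys" "a \<in> carrier G" "ys \<in> tuples G 3"
    using gen(1) by (cases xs) (auto simp: tuples_def)
  let ?m = "d3c (br G ys)"
  have m: "?m \<in> carrier M" "bd ?m = \<one>\<^bsub>F\<^esub>"
    using xs by (simp_all add: bd_d3c)
  \<comment> \<open>\<open>inv a\<close> is written as the image of a lift in \<open>F\<close>, the
    form in which \<open>d3c_act\<close> applies.\<close>
  have "std_bd G (br G xs) = free_mod_act G (br G ys) (\<phi> (inv\<^bsub>F\<^esub> (letter a))) - h2c a ?m"
    using std_bd_shift_3[of "br G ys" a] xs by (simp add: std_shift_br)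
  moreover have "d3c (free_mod_act G (br G ys) (\<phi> (inv\<^bsub>F\<^esub> (letter a)))) = act ?m (inv\<^bsub>F\<^esub> (letter a))"
    using xs by (intro d3c_act) simp_all
  ultimately have "d3c (std_bd G (br G xs)) = act ?m (inv\<^bsub>F\<^esub> (letter a)) \<otimes>\<^bsub>M\<^esub> inv\<^bsub>M\<^esub> (theta a ?m)"
    using xs m by (simp add: hom_free_mod_diff[OF d3c_hom X.M.is_group] free_mod_act_closed d3c_h2c)
  \<comment> \<open>As \<open>bd ?m\<close> is the unit, the \<open>h_1\<close> factor of
    \<open>theta a ?m\<close> disappears, leaving exactly the translate of \<open>?m\<close> by
    \<open>inv (letter a)\<close>.\<close>
  also have "\<dots> = \<one>\<^bsub>M\<^esub>"
    using xs m by (simp add: theta_def)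
  finally have *: "d3c (std_bd G (br G xs)) = \<one>\<^bsub>M\<^esub>" .
  have cl: "br G xs \<in> carrier (C (Suc 3))"
    using gen(1) by simp
  have "std_bd G (frag_of (xs, k)) = free_mod_act G (std_bd G (br G xs)) (\<phi> (letter k))"
    using gen(2) std_bd_act[OF cl gen(2)] by (simp add: br_eq)
  then show ?case
    using d3c_act[OF std_bd_closed[OF cl] letter_F[OF gen(2)]] * gen(2)
      act_bd[of "\<one>\<^bsub>M\<^esub>" "\<one>\<^bsub>M\<^esub>"] hom_one[OF act_hom[OF letter_F[OF gen(2)]] X.M.is_group X.M.is_group]
    by simp
next
  case (diff c d)
  have "std_bd G c \<in> carrier (C 3)" "std_bd G d \<in> carrier (C 3)"
    using diff std_bd_closed[of _ 3] by simp_all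
  with diff show ?case
    by (simp add: std_bd_diff hom_free_mod_diff[OF d3c_hom X.M.is_group])
qed

lemma std_bd_std_bd_br_Cons:
  assumes "a \<in> carrier G" "xs \<in> tuples G (Suc n)"
  shows "std_bd G (std_bd G (br G (a # xs))) =
    free_mod_act G (std_bd G (br G xs)) (inv a) - std_bd G (std_shift G a (std_bd G (br G xs)))"
proof -
  have xs: "br G xs \<in> carrier (C (Suc n))"
    using assms(2) by simp
  have "std_bd G (br G (a # xs)) = free_mod_act G (br G xs) (inv a) - std_shift G a (std_bd G (br G xs))"
    using std_bd_shift[OF xs assms(1)] assms by (simp add: std_shift_br)
  then show ?thesis
    using std_bd_act[OF xs] assms(1) by (simp add: std_bd_diff)
qed

lemma std_bd_std_bd_eq_0I:
  assumes "\<And>a xs. a \<in> carrier G \<Longrightarrow> xs \<in> tuples G (Suc n) \<Longrightarrow> std_bd G (std_bd G (br G (a # xs))) = 0"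
    and "c \<in> carrier (C (Suc (Suc n)))"
  shows "std_bd G (std_bd G c) = 0"
  using assms(2)
proof (induction rule: free_mod_induct)
  case (gen xs k)
  obtain a ys where xs: "xs = a # ys" "a \<in> carrier G" "ys \<in> tuples G (Suc n)"
    using gen(1) by (cases xs) (auto simp: tuples_def)
  have cl: "br G xs \<in> carrier (C (Suc (Suc n)))"
    using gen(1) by simp
  have "std_bd G (std_bd G (frag_of (xs, k))) = free_mod_act G (std_bd G (std_bd G (br G xs))) k"
    by (simp only: free_mod_gen_eq_act_br[OF gen(2)] std_bd_act[OF cl gen(2)]
        std_bd_act[OF std_bd_closed[OF cl] gen(2)])
  then show ?case
    using assms(1)[OF xs(2,3)] xs(1) by simp
qed (simp_all add: std_bd_diff)

text \<open>By the homotopy identity the double boundary of \<open>[a, xs]\<close> is the homotopy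
  applied to the double boundary of \<open>[xs]\<close> over \<open>a\<close>, one dimension lower.
  The induction starts in dimension 5, where that inner composite ends with \<open>delta_3\<close>
  and \<open>d3c_std_bd\<close> takes over.\<close>

lemma std_bd_std_bd:
  assumes "c \<in> carrier (C (Suc (Suc (n + 3))))"
  shows "std_bd G (std_bd G c) = 0"
  using assms
proof (induction n arbitrary: c)
  case 0
  show ?case
  proof (rule std_bd_std_bd_eq_0I[OF _ "0"])
    fix a xs assume a: "a \<in> carrier G" and xs: "xs \<in> tuples G (Suc (0 + 3))"
    then have "br G xs \<in> carrier (C (Suc 3))"
      by simp
    from std_bd_closed[OF this] this a
    show "std_bd G (std_bd G (br G (a # xs))) = 0"
      using hom_one[OF h2c_hom X.M.is_group C.is_group]
      by (simp add: std_bd_std_bd_br_Cons[OF a xs] std_bd_shift_3 d3c_std_bd)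
  qed
next
  case (Suc n)
  show ?case
  proof (rule std_bd_std_bd_eq_0I[OF _ Suc.prems])
    fix a xs assume a: "a \<in> carrier G" and xs: "xs \<in> tuples G (Suc (Suc n + 3))"
    then have "br G xs \<in> carrier (C (Suc (Suc (n + 3))))"
      by simp
    from std_bd_shift[OF std_bd_closed[OF this] a] Suc.IH[OF this]
    show "std_bd G (std_bd G (br G (a # xs))) = 0"
      by (simp add: std_bd_std_bd_br_Cons[OF a xs])
  qed
qed

end

section \<open>Groups in the fibres of the universal cover\<close>

lemma group_fibre:
  assumes "group M"
  shows "group (fibre M g)"
proof -
  interpret group M by (fact assms)
  show ?thesis
    by (rule groupI) (auto simp: fibre_def m_assoc intro: l_inv_ex)
qed

lemma carrier_fibre: "carrier (fibre M g) = {g} \<times> carrier M"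
  by (simp add: fibre_def)

lemma mult_fibre: "x \<otimes>\<^bsub>fibre M g\<^esub> y = (g, snd x \<otimes>\<^bsub>M\<^esub> snd y)"
  by (simp add: fibre_def)

lemma inv_fibre:
  assumes "group M" "x \<in> carrier M"
  shows "inv\<^bsub>fibre M g\<^esub> (g, x) = (g, inv\<^bsub>M\<^esub> x)"
proof -
  interpret group M by (fact assms)
  show ?thesis
    by (rule group.inv_equality[OF group_fibre[OF assms(1)]])
      (use assms in \<open>simp_all add: fibre_def\<close>)
qed

context standard_resolution
begin

section \<open>Exactness and the contracting homotopy\<close>

abbreviation std :: "('g, 'g std1, 'g std2, 'g stdn) crossed_data" where
  "std \<equiv> standard_crossed_data G d3c (\<lambda>_. std_bd G)"

lemma std_simps [simp]:
  "C1 std = F" "phi std = \<phi>" "C2 std = M" "act2 std = act" "d2 std = bd"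
  "Cn std = C" "actn std = (\<lambda>_. free_mod_act G)" "d3 std = d3c" "dn std = (\<lambda>_. std_bd G)"
  by (simp_all add: standard_crossed_data_def)

lemma \<phi>_surj: "\<phi> ` carrier F = carrier G"
proof
  show "carrier G \<subseteq> \<phi> ` carrier F"
    by (metis \<phi>_letter image_eqI letter_F subsetI)
qed auto

lemma image_bd: "bd ` carrier M = kernel F G \<phi>"
  using kernel_\<phi>_eq_image_bd by (auto simp: kernel_def)

lemma std_bd_hom: "std_bd G \<in> hom (C (Suc n)) (C n)"
  by (rule homI) (simp_all add: std_bd_closed std_bd_add)

lemma std_shift_hom: "g \<in> carrier G \<Longrightarrow> std_shift G g \<in> hom (C n) (C (Suc n))"
  by (rule homI) (simp_all add: std_shift_closed std_shift_add)

lemma exact_2: "kernel M F bd = d3c ` carrier (C 3)"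
proof
  show "d3c ` carrier (C 3) \<subseteq> kernel M F bd"
    by (auto simp: kernel_def bd_d3c)
  show "kernel M F bd \<subseteq> d3c ` carrier (C 3)"
  proof
    fix m assume "m \<in> kernel M F bd"
    then have m: "m \<in> carrier M" "bd m = \<one>\<^bsub>F\<^esub>"
      by (auto simp: kernel_def)
    have "d3c (h2c \<one> m) = act m (inv\<^bsub>F\<^esub> (letter \<one>))"
      using m by (simp add: d3c_h2c theta_def)
    \<comment> \<open>\<open>h_0\<close> at the base point is labelled \<open>[1]^-1\<close>, a lift
      of \<open>\<one>\<close>, and therefore acts trivially on \<open>ker bd\<close>.\<close>
    also have "\<dots> = m"
      using kernel_bd_act_cong[OF m, of "inv\<^bsub>F\<^esub> (letter \<one>)" "\<one>\<^bsub>F\<^esub>"] m by (simp add: act_one)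
    finally show "m \<in> d3c ` carrier (C 3)"
      using m by (metis h2c_closed image_eqI one_closed)
  qed
qed

lemma exact_3: "kernel (C 3) M d3c = std_bd G ` carrier (C 4)"
proof
  show "std_bd G ` carrier (C 4) \<subseteq> kernel (C 3) M d3c"
    using std_bd_closed[of _ 3] by (auto simp: kernel_def d3c_std_bd)
  show "kernel (C 3) M d3c \<subseteq> std_bd G ` carrier (C 4)"
  proof
    fix c assume "c \<in> kernel (C 3) M d3c"
    then have c: "c \<in> carrier (C 3)" "d3c c = \<one>\<^bsub>M\<^esub>"
      by (auto simp: kernel_def)
    \<comment> \<open>The homotopy identity at base point one: the term through \<open>d3c c\<close>
      vanishes and the action is by the unit of \<open>G\<close>.\<close>
    then have "c = std_bd G (std_shift G \<one> c)"
      using hom_one[OF h2c_hom X.M.is_group C.is_group, of \<one>]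
      by (simp add: std_bd_shift_3 free_mod_act_one)
    then show "c \<in> std_bd G ` carrier (C 4)"
      using std_shift_closed[OF c(1) one_closed] by auto
  qed
qed

lemma exact_n:
  assumes "n \<ge> 4"
  shows "kernel (C n) (C (n - 1)) (std_bd G) = std_bd G ` carrier (C (n + 1))"
proof
  obtain k where k: "n = k + 4"
    using assms by (metis add.commute le_Suc_ex)
  show "std_bd G ` carrier (C (n + 1)) \<subseteq> kernel (C n) (C (n - 1)) (std_bd G)"
  proof
    fix d assume "d \<in> std_bd G ` carrier (C (n + 1))"
    then obtain c where c: "d = std_bd G c" "c \<in> carrier (C (Suc (Suc (k + 3))))"
      by (auto simp: k add.commute)
    from std_bd_closed[OF c(2)] std_bd_std_bd[OF c(2)]
    show "d \<in> kernel (C n) (C (n - 1)) (std_bd G)"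
      by (simp add: kernel_def k c(1) add.commute)
  qed
  show "kernel (C n) (C (n - 1)) (std_bd G) \<subseteq> std_bd G ` carrier (C (n + 1))"
  proof
    fix c assume "c \<in> kernel (C n) (C (n - 1)) (std_bd G)"
    then have c: "c \<in> carrier (C (Suc (k + 3)))" "std_bd G c = 0"
      by (auto simp: kernel_def k add.commute)
    then have "c = std_bd G (std_shift G \<one> c)"
      by (simp only: std_bd_shift[OF c(1) one_closed]) (simp add: free_mod_act_one)
    then show "c \<in> std_bd G ` carrier (C (n + 1))"
      using std_shift_closed[OF c(1) one_closed] by (auto simp: k add.commute)
  qed
qed

lemma free_crossed_resolution_std:
  "free_crossed_resolution_on TYPE('t) G std (carrier G) br1 (carrier G \<times> carrier G) (br2 G)
     (tuples G) (\<lambda>n. br G)"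
  unfolding free_crossed_resolution_on_def std_simps
proof (intro conjI allI impI ballI)
  show "free_group_on TYPE('t) F (carrier G) br1"
    unfolding br1_def std_C1_def by (rule free_group_on_free_group)
  \<comment> \<open>Freeness is demanded over the composite of \<open>bd\<close> with
    \<open>br2 G\<close>, but was constructed over \<open>std_relator G\<close>; the two agree on
    the generators.\<close>
  have bd_br2': "s \<in> carrier G \<times> carrier G \<Longrightarrow> bd (br2 G s) = std_relator G s" for s
    by (simp add: br2_def X.free_xmod_bd_gen)
  have "free_crossed_module_on TYPE('t) F (carrier G \<times> carrier G) (std_relator G) M act bd (br2 G)"
    unfolding br2_def by (rule X.free_crossed_module_on_free_xmod)
  then show "free_crossed_module_on TYPE('t) F (carrier G \<times> carrier G) (\<lambda>s. bd (br2 G s)) M act bd (br2 G)"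
    by (simp add: free_crossed_module_on_def bd_br2' cong: ball_cong)
  show "free_module_on TYPE('t) G (C n) (free_mod_act G) (tuples G n) (br G)" for n
    unfolding br_def by (rule free_module_on_free_mod)
  show "std_bd G \<in> hom (C n) (C (n - 1))" if "4 \<le> n" for n
    using that std_bd_hom[of "n - 1"] by simp
  show "std_bd G (free_mod_act G c g) = free_mod_act G (std_bd G c) g"
    if "4 \<le> n" "c \<in> carrier (C n)" "g \<in> carrier G" for n c g
    using that std_bd_act[of c "n - 1" g] by simp
qed (simp_all add: is_group \<phi>_hom \<phi>_surj image_bd d3c_hom d3c_act exact_2 exact_3 exact_n[simplified])

lemma contracting_homotopy_std:
  "contracting_homotopy G std (\<lambda>g. (g, inv\<^bsub>F\<^esub> (letter g))) (\<lambda>(g, u). (\<one>, cov_val G g u))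
     (\<lambda>(g, m). (\<one>, h2c g m)) (\<lambda>n (g, c). (\<one>, std_shift G g c))"
  unfolding contracting_homotopy_def std_simps
proof (intro conjI allI impI ballI)
  fix g assume g: "g \<in> carrier G"
  show "(\<lambda>(g, m). (\<one>, h2c g m)) \<in> hom (fibre M g) (fibre (C 3) \<one>)"
    by (rule homI) (use g hom_mult[OF h2c_hom[OF g]] in
        \<open>auto simp: carrier_fibre mult_fibre\<close>)
next
  fix n :: nat and g assume g: "g \<in> carrier G"
  show "(\<lambda>(g, c). (\<one>, std_shift G g c)) \<in> hom (fibre (C n) g) (fibre (C (n + 1)) \<one>)"
    by (rule homI) (use g hom_mult[OF std_shift_hom[OF g]] std_shift_closed[of _ n g] in
        \<open>auto simp: carrier_fibre mult_fibre\<close>)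
next
  fix n :: nat and g x a
  assume "g \<in> carrier G" "x \<in> carrier (fibre (C n) g)" "a \<in> cov_arrows G std" "cov_source a = g"
  then show "(case cov_act G std n x a of (g, c) \<Rightarrow> (\<one>, std_shift G g c)) =
      (case x of (g, c) \<Rightarrow> (\<one>, std_shift G g c))"
    using std_shift_act[of "snd x" n "g \<otimes> \<phi> (snd a)" "\<phi> (snd a)"]
    by (auto simp: cov_act_def carrier_fibre cov_arrows_def cov_source_def cov_target_def m_assoc)
next
  fix n :: nat and g x
  assume n: "4 \<le> n" and g: "g \<in> carrier G" and x: "x \<in> carrier (fibre (C n) g)"
  then obtain c where c: "x = (g, c)" "c \<in> carrier (C (Suc (n - 1)))"
    by (auto simp: carrier_fibre)
  have cl: "std_shift G g (std_bd G c) \<in> carrier (C n)"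
    using std_shift_closed[OF std_bd_closed[OF c(2)] g] n by simp
  show "cov_map (std_bd G) (case x of (g, c) \<Rightarrow> (\<one>, std_shift G g c)) =
      inv\<^bsub>fibre (C n) \<one>\<^esub> (case cov_map (std_bd G) x of (g, c) \<Rightarrow> (\<one>, std_shift G g c)) \<otimes>\<^bsub>fibre (C n) \<one>\<^esub>
      cov_act G std n x (g, inv\<^bsub>F\<^esub> (letter g))"
    using g c inv_fibre[OF C.is_group cl, of \<one>] cl
    by (simp add: cov_map_def mult_fibre cov_act_def std_bd_shift[OF c(2)])
next
  fix g x
  assume g: "g \<in> carrier G" and x: "x \<in> carrier (fibre (C 3) g)"
  then obtain c where c: "x = (g, c)" "c \<in> carrier (C 3)"
    by (auto simp: carrier_fibre)
  have cl: "h2c g (d3c c) \<in> carrier (C 3)"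
    using c g by simp
  show "cov_map (std_bd G) (case x of (g, c) \<Rightarrow> (\<one>, std_shift G g c)) =
      inv\<^bsub>fibre (C 3) \<one>\<^esub> (case cov_map d3c x of (g, m) \<Rightarrow> (\<one>, h2c g m)) \<otimes>\<^bsub>fibre (C 3) \<one>\<^esub>
      cov_act G std 3 x (g, inv\<^bsub>F\<^esub> (letter g))"
    using g c inv_fibre[OF C.is_group cl, of \<one>] cl
    by (simp add: cov_map_def mult_fibre cov_act_def std_bd_shift_3)
next
  fix g x
  assume g: "g \<in> carrier G" and x: "x \<in> carrier (fibre M g)"
  then obtain m where m: "x = (g, m)" "m \<in> carrier M"
    by (auto simp: carrier_fibre)
  have cl: "cov_val G g (bd m) \<in> carrier M"
    using m g by simp
  show "cov_map d3c (case x of (g, m) \<Rightarrow> (\<one>, h2c g m)) =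
      inv\<^bsub>fibre M \<one>\<^esub> (case cov_map bd x of (g, u) \<Rightarrow> (\<one>, cov_val G g u)) \<otimes>\<^bsub>fibre M \<one>\<^esub>
      cov_act2 G std x (g, inv\<^bsub>F\<^esub> (letter g))"
    using g m inv_fibre[OF X.M.is_group cl, of \<one>]
    by (simp add: cov_map_def mult_fibre cov_act2_def d3c_h2c theta_def)
next
  fix g x a
  assume "g \<in> carrier G" "x \<in> carrier (fibre M g)" "a \<in> cov_arrows G std" "cov_source a = g"
  then show "(case cov_act2 G std x a of (g, m) \<Rightarrow> (\<one>, h2c g m)) = (case x of (g, m) \<Rightarrow> (\<one>, h2c g m))"
    by (auto simp: cov_act2_def carrier_fibre cov_arrows_def cov_source_def cov_target_def m_assoc h2c_act)
\<comment> \<open>What remains is the typing of \<open>h_0\<close> and \<open>h_1\<close>, the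
  functoriality of \<open>h_1\<close>, and its homotopy identity \<open>bd_cov_val\<close>.\<close>
qed (auto simp: cov_arrows_def cov_source_def cov_target_def cov_comp_def cov_inv_def cov_map_def
    carrier_fibre mult_fibre cov_val_mult bd_cov_val)

end

theorem theorem10p1:
  fixes G :: "'g monoid"
  assumes "group G"
  shows "\<exists>(\<delta>\<^sub>3 :: 'g stdn \<Rightarrow> 'g std2) (\<delta> :: nat \<Rightarrow> 'g stdn \<Rightarrow> 'g stdn).
    let R = standard_crossed_data G \<delta>\<^sub>3 \<delta> in
      free_crossed_resolution_on TYPE('t) G R
        (carrier G) br1 (carrier G \<times> carrier G) (br2 G) (tuples G) (\<lambda>n. br G) \<and>
      (\<forall>a\<in>carrier G. phi R (br1 a) = a) \<and>
      (\<forall>a\<in>carrier G. \<forall>b\<in>carrier G.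
         d2 R (br2 G (a, b)) =
           br1 a \<otimes>\<^bsub>C1 R\<^esub> br1 b \<otimes>\<^bsub>C1 R\<^esub> inv\<^bsub>C1 R\<^esub> (br1 (a \<otimes>\<^bsub>G\<^esub> b))) \<and>
      (\<forall>a\<in>carrier G. \<forall>b\<in>carrier G. \<forall>c\<in>carrier G.
         d3 R (br G [a, b, c]) =
           br2 G (a, b \<otimes>\<^bsub>G\<^esub> c) \<otimes>\<^bsub>C2 R\<^esub> inv\<^bsub>C2 R\<^esub> (br2 G (a \<otimes>\<^bsub>G\<^esub> b, c)) \<otimes>\<^bsub>C2 R\<^esub>
           inv\<^bsub>C2 R\<^esub> (br2 G (a, b)) \<otimes>\<^bsub>C2 R\<^esub> act2 R (br2 G (b, c)) (inv\<^bsub>C1 R\<^esub> (br1 a))) \<and>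
      (\<forall>n\<ge>4. \<forall>xs\<in>tuples G n.
         dn R n (br G xs) =
           actn R (n - 1) (br G (tl xs)) (inv\<^bsub>G\<^esub> (xs ! 0))
           + (\<Sum>i = 1..n - 1. frag_cmul ((- 1) ^ i)
                (br G (take (i - 1) xs @ [xs ! (i - 1) \<otimes>\<^bsub>G\<^esub> xs ! i] @ drop (i + 1) xs)))
           + frag_cmul ((- 1) ^ n) (br G (butlast xs))) \<and>
      (\<exists>h0 h1 h2 h.
         contracting_homotopy G R h0 h1 h2 h \<and>
         (\<forall>a\<in>carrier G. h0 a = (a, inv\<^bsub>C1 R\<^esub> (br1 a))) \<and>
         (\<forall>a\<in>carrier G. \<forall>b\<in>carrier G. h1 (a, br1 b) = (\<one>\<^bsub>G\<^esub>, br2 G (a, b))) \<and>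
         (\<forall>a\<in>carrier G. \<forall>b\<in>carrier G. \<forall>c\<in>carrier G.
            h2 (a, br2 G (b, c)) = (\<one>\<^bsub>G\<^esub>, br G [a, b, c])) \<and>
         (\<forall>n\<ge>3. \<forall>a\<in>carrier G. \<forall>xs\<in>tuples G n. h n (a, br G xs) = (\<one>\<^bsub>G\<^esub>, br G (a # xs))))"
proof -
  interpret standard_resolution G
    by (simp add: standard_resolution_def assms)
  have bd_n: "std_bd G (br G xs) = free_mod_act G (br G (tl xs)) (inv\<^bsub>G\<^esub> (xs ! 0))
      + (\<Sum>i = 1..n - 1. frag_cmul ((- 1) ^ i)
           (br G (take (i - 1) xs @ [xs ! (i - 1) \<otimes>\<^bsub>G\<^esub> xs ! i] @ drop (i + 1) xs)))
      + frag_cmul ((- 1) ^ n) (br G (butlast xs))" if "4 \<le> n" "xs \<in> tuples G n" for n xs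
  proof -
    have "std_bd G (br G xs) = std_bd_gen G xs"
      using that by (intro std_bd_br[OF std_bd_gen_closed[of _ "n - 1"]]) simp
    moreover have "length xs = n"
      using that by (simp add: tuples_def)
    ultimately show ?thesis
      by (simp only: std_bd_gen_def)
  qed
  show ?thesis
    unfolding Let_def
  proof (intro exI conjI)
    show "contracting_homotopy G std (\<lambda>g. (g, inv\<^bsub>F\<^esub> (letter g))) (\<lambda>(g, u). (\<one>\<^bsub>G\<^esub>, cov_val G g u))
        (\<lambda>(g, m). (\<one>\<^bsub>G\<^esub>, h2c g m)) (\<lambda>n (g, c). (\<one>\<^bsub>G\<^esub>, std_shift G g c))"
      by (rule contracting_homotopy_std)
    show "free_crossed_resolution_on TYPE('t) G std (carrier G) br1 (carrier G \<times> carrier G) (br2 G)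
        (tuples G) (\<lambda>n. br G)"
      by (rule free_crossed_resolution_std)
  qed (unfold std_simps, auto simp: br1_def bd_br2 d3c_br tuples_3
      d3_gen_def theta_br2 cov_val_letter h2c_br2 std_shift_br bd_n simp del: One_nat_def)
qed

end
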